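(* For every positive integer $m$ there exists a compact metrizable space $X$ with $\dim X=m$ such that $C(X)$ is approximately $n$-th root closed for all positive integers $n$.
   Context: $\dim$ denotes covering dimension. $C(X)$ denotes the algebra of all bounded continuous complex-valued functions on $X$ with the supremum norm $\|\cdot\|$. $C(X)$ is called approximately $n$-th root closed if for every $f\in C(X)$ and every $\varepsilon>0$ there exists $g\in C(X)$ with $\|f-g^n\|<\varepsilon$. *)

theory Defs
  imports "HOL-Analysis.Analysis"
begin

definition open_cover :: "'a topology \<Rightarrow> 'a set set \<Rightarrow> bool" where
  "open_cover X \<U> \<longleftrightarrow> (\<forall>U\<in>\<U>. openin X U) \<and> \<Union>\<U> = topspace X"

definition refines :: "'a set set \<Rightarrow> 'a set set \<Rightarrow> bool" where
  "refines \<V> \<U> \<longleftrightarrow> (\<forall>V\<in>\<V>. \<exists>U\<in>\<U>. V \<subseteq> U)"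

(* The parameter k counts members through a point, so this is dim X <= k - 1. *)
definition refinable_with_multiplicity :: "'a topology \<Rightarrow> nat \<Rightarrow> bool" where
  "refinable_with_multiplicity X k \<longleftrightarrow>
     (\<forall>\<U>. finite \<U> \<and> open_cover X \<U> \<longrightarrow>
        (\<exists>\<V>. finite \<V> \<and> open_cover X \<V> \<and> refines \<V> \<U> \<and>
             (\<forall>x\<in>topspace X. card {V \<in> \<V>. x \<in> V} \<le> k)))"

(* Lebesgue covering dimension, via finite open covers.  The value is -1 exactly for the
   empty space, and infinity (the infimum of the empty set) when no finite bound exists. *)
definition covering_dim :: "'a topology \<Rightarrow> ereal" where
  "covering_dim X = (INF k\<in>{k. refinable_with_multiplicity X k}. ereal (real k - 1))"

(* Only values on topspace X matter; the carrier type is in general larger than X. *)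
definition bounded_continuous_functions :: "'a topology \<Rightarrow> ('a \<Rightarrow> complex) set" where
  "bounded_continuous_functions X =
     {f. continuous_map X euclidean f \<and> bounded (f ` topspace X)}"

(* Inserting 0 only matters for the empty space, where it makes the norm 0. *)
definition sup_norm :: "'a topology \<Rightarrow> ('a \<Rightarrow> complex) \<Rightarrow> real" where
  "sup_norm X f = Sup (insert 0 ((\<lambda>x. norm (f x)) ` topspace X))"

definition approximately_root_closed :: "'a topology \<Rightarrow> nat \<Rightarrow> bool" where
  "approximately_root_closed X n \<longleftrightarrow>
     (\<forall>f\<in>bounded_continuous_functions X. \<forall>\<epsilon>>0.
        \<exists>g\<in>bounded_continuous_functions X. sup_norm X (\<lambda>x. f x - g x ^ n) < \<epsilon>)"

end

theory Submission
  imports Defs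
begin

text \<open>
  The space is an inverse limit of Cole extensions of the cube \<open>[0,1]\<^sup>m\<close>: at level \<open>k\<close> one adjoins a
  coordinate \<open>z\<close> with \<open>z\<^sup>n = f\<close>, where \<open>f\<close> runs through rational polynomials in the coordinates
  adjoined before and \<open>n\<close> through all exponents. By Stone--Weierstrass the functions with exact roots
  are dense. The projection to the cube has profinite fibres, so covers of the cube by \<open>m + 1\<close>
  disjoint families of small open sets lift, and the dimension is at most \<open>m\<close>.

  If the dimension were smaller, the space would be covered by \<open>m\<close> disjoint families of open sets none
  of which meets two opposite faces. This gives functions \<open>u i\<close> for \<open>i < m\<close> with values in \<open>{0, 1}\<close> such that
  \<open>u i\<close> separates the \<open>i\<close>-th pair of opposite faces and on every small set some \<open>u i\<close> is constant, so
  the cup product of their coboundaries vanishes on all small simplices. But a small simplex of a fine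
  grid in the cube has finitely many small lifts to the space, compatibly with passing to faces, and by
  the discrete Stokes formula the average over these lifts of the cup product has total degree \<open>1\<close>.
  This transfer needs no tameness of the branch locus: where \<open>f\<close> is small all its roots are small, so a
  single root may serve for all branches.
\<close>

subsection \<open>The discrete Stokes formula on a grid\<close>

text \<open>The obstacle is that the projection to the cube need not have continuous sections, not
  even locally at zeros of \<open>f\<close>, so neither functions nor triangulations can simply be
  pulled back. Counting all lifts with multiplicity and averaging replaces a section: monodromy only
  permutes the terms. Division by the number of sheets is why the cochains are real-valued. The
  degree argument evaluates everything at finitely many vertices, so a lift is a map on a vertex set
  and no continuity of \<open>u i\<close> enters; this is why an open cover is enough as input.
  Scales are chosen from the top of the tower downwards: a Lebesgue number fixes a finite level and
  a tolerance there, uniform continuity of each \<open>f k\<close> carries the tolerance one level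
  down, and the mesh of the grid is chosen last, on the cube.\<close>

lemma sum_permutes_transpose_zero:
  fixes G :: "('a \<Rightarrow> 'a) \<Rightarrow> real"
  assumes "finite S" "a \<in> S" "b \<in> S" "a \<noteq> b"
    and inv: "\<And>\<pi>. \<pi> permutes S \<Longrightarrow> G (\<pi> \<circ> Transposition.transpose a b) = G \<pi>"
  shows "(\<Sum>\<pi> | \<pi> permutes S. of_int (sign \<pi>) * G \<pi>) = 0"
proof -
  let ?P = "{\<pi>. \<pi> permutes S}" and ?t = "Transposition.transpose a b"
  have t: "?t permutes S"
    using assms by (simp add: permutes_swap_id)
  have "(\<Sum>\<pi>\<in>?P. of_int (sign \<pi>) * G \<pi>) = (\<Sum>\<pi>\<in>?P. of_int (sign (\<pi> \<circ> ?t)) * G (\<pi> \<circ> ?t))"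
  proof (rule sum.reindex_bij_betw[symmetric], rule bij_betwI[where g="\<lambda>\<pi>. \<pi> \<circ> ?t"])
    show "(\<lambda>\<pi>. \<pi> \<circ> ?t) \<in> ?P \<rightarrow> ?P" "(\<lambda>\<pi>. \<pi> \<circ> ?t) \<in> ?P \<rightarrow> ?P"
      using t by (auto intro: permutes_compose)
  qed (simp_all add: comp_assoc)
  also have "\<dots> = (\<Sum>\<pi>\<in>?P. - (of_int (sign \<pi>) * G \<pi>))"
  proof (rule sum.cong[OF refl])
    fix \<pi> assume "\<pi> \<in> ?P"
    then have p: "\<pi> permutes S" by simp
    have "sign (\<pi> \<circ> ?t) = - sign \<pi>"
      using sign_compose[of \<pi> ?t] p t assms permutation_permutes
      by (metis mult.commute mult_minus1 sign_swap_id)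
    then show "of_int (sign (\<pi> \<circ> ?t)) * G (\<pi> \<circ> ?t) = - (of_int (sign \<pi>) * G \<pi>)"
      using inv[OF p] by simp
  qed
  finally show ?thesis by (simp add: sum_negf)
qed

section \<open>Cup products on Kuhn simplices and their coboundary formula\<close>

definition step :: "(nat \<Rightarrow> nat) \<Rightarrow> nat set \<Rightarrow> nat \<Rightarrow> nat" where
  "step p A = (\<lambda>x. if x \<in> A then Suc (p x) else p x)"

text \<open>The cup product of the coboundaries of \<open>y j, \<dots>, y (m - 1)\<close>, evaluated on the simplex of the Kuhn
  triangulation with vertices \<open>p\<close>, \<open>p + e (\<pi> j)\<close>, \<open>p + e (\<pi> j) + e (\<pi> (j + 1))\<close>, \<open>\<dots>\<close>\<close>

definition cup :: "nat \<Rightarrow> nat \<Rightarrow> (nat \<Rightarrow> (nat \<Rightarrow> nat) \<Rightarrow> real) \<Rightarrow> (nat \<Rightarrow> nat) \<Rightarrow> (nat \<Rightarrow> nat) \<Rightarrow> real" where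
  "cup j m y p \<pi> = (\<Prod>i\<in>{j..<m}. y i (step p (\<pi> ` {j..i})) - y i (step p (\<pi> ` {j..<i})))"

lemma image_transpose_eq:
  assumes "a \<in> A \<longleftrightarrow> b \<in> A"
  shows "(\<pi> \<circ> Transposition.transpose a b) ` A = \<pi> ` A"
  using assms unfolding image_comp[symmetric] by simp

text \<open>The cup product is a cocycle. The direction \<open>\<pi> j\<close> is removed from one factor after the other; the
  change in the factor \<open>k\<close> is invariant under the transposition of \<open>j\<close> and \<open>k\<close>.\<close>

lemma sum_shift_cup:
  fixes y :: "nat \<Rightarrow> (nat \<Rightarrow> nat) \<Rightarrow> real"
  assumes "j < m"
  shows "(\<Sum>\<pi> | \<pi> permutes {j..<m}. of_int (sign \<pi>) *
             (\<Prod>i\<in>{Suc j..<m}. y i (step p (\<pi> ` {j..i})) - y i (step p (\<pi> ` {j..<i}))))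
       = (\<Sum>\<pi> | \<pi> permutes {j..<m}. of_int (sign \<pi>) * cup (Suc j) m y p \<pi>)"
proof -
  define B where "B \<pi> i = y i (step p (\<pi> ` {Suc j..i})) - y i (step p (\<pi> ` {Suc j..<i}))" for \<pi> i
  define A where "A \<pi> i = y i (step p (\<pi> ` {j..i})) - y i (step p (\<pi> ` {j..<i}))" for \<pi> i
  \<comment> \<open>\<open>Z k\<close> interpolates: factors below \<open>k\<close> have lost the
    direction \<open>\<pi> j\<close>, the others still contain it. The left side of the claim is
    \<open>Z (Suc j)\<close>, the right side \<open>Z m\<close>.\<close>
  define Z where "Z k \<pi> = (\<Prod>i\<in>{Suc j..<k}. B \<pi> i) * (\<Prod>i\<in>{k..<m}. A \<pi> i)" for k \<pi>
  let ?S = "\<lambda>k. \<Sum>\<pi> | \<pi> permutes {j..<m}. of_int (sign \<pi>) * Z k \<pi>"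
  have step: "?S k = ?S (Suc k)" if k: "k \<in> {Suc j..<m}" for k
  proof -
    have "(\<Sum>\<pi> | \<pi> permutes {j..<m}. of_int (sign \<pi>) * (Z k \<pi> - Z (Suc k) \<pi>)) = 0"
    proof (rule sum_permutes_transpose_zero[where a=j and b=k])
      fix \<pi> assume "\<pi> permutes {j..<m}"
      let ?\<tau> = "\<pi> \<circ> Transposition.transpose j k"
      have Z: "Z k \<rho> - Z (Suc k) \<rho> = (\<Prod>i\<in>{Suc j..<k}. B \<rho> i) * (A \<rho> k - B \<rho> k) * (\<Prod>i\<in>{Suc k..<m}. A \<rho> i)" for \<rho>
        using k by (simp add: Z_def prod.atLeastLessThan_Suc prod.atLeast_Suc_lessThan algebra_simps)
      have 1: "B ?\<tau> i = B \<pi> i" if "i \<in> {Suc j..<k}" for i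
        using that k unfolding B_def by (subst (1 2) image_transpose_eq) auto
      have 2: "A ?\<tau> i = A \<pi> i" if "i \<in> {Suc k..<m}" for i
        using that k unfolding A_def by (subst (1 2) image_transpose_eq) auto
      have s1: "?\<tau> ` {j..k} = \<pi> ` {j..k}" "?\<tau> ` {Suc j..<k} = \<pi> ` {Suc j..<k}"
        using k by (subst image_transpose_eq; auto)+
      have t: "Transposition.transpose j k ` {j..<k} = {Suc j..k}"
      proof -
        have "{j..<k} = insert j {Suc j..<k}" "{Suc j..k} = insert k {Suc j..<k}"
          using k by auto
        moreover have "Transposition.transpose j k ` {Suc j..<k} = {Suc j..<k}"
          by (rule transpose_image_eq) auto
        ultimately show ?thesis by simp
      qed
      have t': "Transposition.transpose j k ` {Suc j..k} = {j..<k}"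
        unfolding t[symmetric] by (simp add: image_comp)
      have s2: "?\<tau> ` {j..<k} = \<pi> ` {Suc j..k}" "?\<tau> ` {Suc j..k} = \<pi> ` {j..<k}"
        unfolding image_comp[symmetric] t t' by simp_all
      \<comment> \<open>This is a mixed second difference: the transposition fixes the outer sets
        \<open>s1\<close> and exchanges the two middle sets \<open>s2\<close>, which enter with the
        same sign.\<close>
      have 3: "A ?\<tau> k - B ?\<tau> k = A \<pi> k - B \<pi> k"
        unfolding A_def B_def s1 s2 by simp
      show "Z k ?\<tau> - Z (Suc k) ?\<tau> = Z k \<pi> - Z (Suc k) \<pi>"
        unfolding Z 3 using 1 2 by simp
    qed (use k in auto)
    then show ?thesis by (simp add: algebra_simps sum_subtractf)
  qed
  have "?S (Suc j) = ?S k" if "k \<in> {Suc j..m}" for k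
    using that
  proof (induction k)
    case (Suc k)
    then show ?case using step[of k] by (cases "k = j") auto
  qed simp
  from this[of m] show ?thesis
    using assms by (simp add: Z_def A_def B_def cup_def)
qed

text \<open>\<open>P\<close> splits into lines of \<open>M\<close> points in direction
  \<open>h\<close>, each parametrised by its point with coordinate 0; the sum telescopes along each
  line. The far end \<open>p(h := M)\<close> lies outside \<open>P\<close>.\<close>

lemma sum_telescope_coordinate:
  fixes F :: "(nat \<Rightarrow> nat) \<Rightarrow> real"
  assumes M: "\<And>p. p \<in> P \<Longrightarrow> p h < M"
    and upd: "\<And>p t. p \<in> P \<Longrightarrow> t < M \<Longrightarrow> p(h := t) \<in> P"
  shows "(\<Sum>p\<in>P. F (step p {h}) - F p) = (\<Sum>p | p \<in> P \<and> p h = 0. F (p(h := M)) - F p)"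
proof -
  have step: "step p {h} = p(h := Suc (p h))" for p
    by (auto simp: step_def)
  let ?P0 = "{p \<in> P. p h = 0}"
  have "(\<Sum>p\<in>P. F (step p {h}) - F p) = (\<Sum>(p,t)\<in>?P0 \<times> {..<M}. F (p(h := Suc t)) - F (p(h := t)))"
  proof (rule sum.reindex_bij_witness[where i="\<lambda>(p,t). p(h := t)" and j="\<lambda>p. (p(h := 0), p h)"])
    fix p assume "p \<in> P"
    then show "(p(h := 0), p h) \<in> ?P0 \<times> {..<M}"
      using M[of p] upd[of p 0] by force
  qed (auto simp: step intro: upd)
  also have "\<dots> = (\<Sum>p\<in>?P0. \<Sum>t<M. F (p(h := Suc t)) - F (p(h := t)))"
    by (simp add: sum.cartesian_product)
  also have "\<dots> = (\<Sum>p\<in>?P0. F (p(h := M)) - F p)"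
  proof (rule sum.cong[OF refl])
    fix p assume "p \<in> ?P0"
    then have "p(h := 0) = p" by auto
    then show "(\<Sum>t<M. F (p(h := Suc t)) - F (p(h := t))) = F (p(h := M)) - F p"
      using sum_lessThan_telescope[of "\<lambda>t. F (p(h := t))" M] by simp
  qed
  finally show ?thesis .
qed

lemma step_step_insert:
  assumes "a \<notin> A"
  shows "step (step p {a}) A = step p (insert a A)"
  using assms by (auto simp: step_def)

text \<open>Leibniz rule: a coboundary times a cocycle is the coboundary of the product. Expanding
  the first factor puts both terms over the base point \<open>step p {\<pi> j}\<close>; as
  \<open>y j p\<close> is independent of \<open>\<pi>\<close>, the cocycle property moves the second
  one back to \<open>p\<close>. For fixed \<open>\<pi>\<close> what remains is a difference of one
  function at two neighbouring points, ready to telescope.\<close>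

lemma sum_cup_expand:
  fixes y :: "nat \<Rightarrow> (nat \<Rightarrow> nat) \<Rightarrow> real"
  assumes "j < m"
  shows "(\<Sum>\<pi> | \<pi> permutes {j..<m}. of_int (sign \<pi>) * cup j m y p \<pi>)
       = (\<Sum>\<pi> | \<pi> permutes {j..<m}. of_int (sign \<pi>) *
            (y j (step p {\<pi> j}) * cup (Suc j) m y (step p {\<pi> j}) \<pi> - y j p * cup (Suc j) m y p \<pi>))"
proof -
  let ?R = "\<lambda>\<pi>. \<Prod>i\<in>{Suc j..<m}. y i (step p (\<pi> ` {j..i})) - y i (step p (\<pi> ` {j..<i}))"
  have R: "?R \<pi> = cup (Suc j) m y (step p {\<pi> j}) \<pi>" if "\<pi> permutes {j..<m}" for \<pi>
    unfolding cup_def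
  proof (rule prod.cong[OF refl])
    fix i assume i: "i \<in> {Suc j..<m}"
    have inj: "inj \<pi>" using that by (simp add: permutes_inj)
    have "{j..i} = insert j {Suc j..i}" "{j..<i} = insert j {Suc j..<i}"
      using i by auto
    moreover have "\<pi> j \<notin> \<pi> ` {Suc j..i}" "\<pi> j \<notin> \<pi> ` {Suc j..<i}"
      using inj by (simp_all add: inj_image_mem_iff)
    ultimately show "y i (step p (\<pi> ` {j..i})) - y i (step p (\<pi> ` {j..<i})) =
      y i (step (step p {\<pi> j}) (\<pi> ` {Suc j..i})) - y i (step (step p {\<pi> j}) (\<pi> ` {Suc j..<i}))"
      by (simp add: step_step_insert)
  qed
  have cup: "cup j m y p \<pi> = (y j (step p {\<pi> j}) - y j p) * ?R \<pi>" for \<pi>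
    unfolding cup_def using assms by (simp add: prod.atLeast_Suc_lessThan step_def)
  have "(\<Sum>\<pi> | \<pi> permutes {j..<m}. of_int (sign \<pi>) * cup j m y p \<pi>)
      = (\<Sum>\<pi> | \<pi> permutes {j..<m}. of_int (sign \<pi>) * (y j (step p {\<pi> j}) * ?R \<pi>))
        - y j p * (\<Sum>\<pi> | \<pi> permutes {j..<m}. of_int (sign \<pi>) * ?R \<pi>)"
    unfolding cup by (simp add: algebra_simps sum_subtractf sum_distrib_left)
  also have "(\<Sum>\<pi> | \<pi> permutes {j..<m}. of_int (sign \<pi>) * ?R \<pi>)
      = (\<Sum>\<pi> | \<pi> permutes {j..<m}. of_int (sign \<pi>) * cup (Suc j) m y p \<pi>)"
    by (rule sum_shift_cup[OF assms])
  also have "(\<Sum>\<pi> | \<pi> permutes {j..<m}. of_int (sign \<pi>) * (y j (step p {\<pi> j}) * ?R \<pi>))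
      = (\<Sum>\<pi> | \<pi> permutes {j..<m}. of_int (sign \<pi>) * (y j (step p {\<pi> j}) * cup (Suc j) m y (step p {\<pi> j}) \<pi>))"
    using R by (intro sum.cong) auto
  finally show ?thesis
    by (simp add: sum_distrib_left sum_subtractf algebra_simps)
qed

section \<open>Averages over lifts and the degree of the boundary data\<close>

definition small :: "nat \<Rightarrow> nat \<Rightarrow> (nat \<Rightarrow> nat) set \<Rightarrow> bool" where
  "small m M \<sigma> \<longleftrightarrow> (\<forall>v\<in>\<sigma>. \<forall>i<m. v i \<le> M) \<and> (\<forall>v\<in>\<sigma>. \<forall>v'\<in>\<sigma>. \<forall>i<m. v i \<le> Suc (v' i))"

lemma small_subset: "small m M \<sigma> \<Longrightarrow> \<tau> \<subseteq> \<sigma> \<Longrightarrow> small m M \<tau>"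
  unfolding small_def by blast

text \<open>\<open>E \<sigma>\<close> stands for an average over finitely many lifts of the vertex set \<open>\<sigma>\<close>; \<open>restrict\<close> says that the
  lifts of a subset are the restrictions of those of \<open>\<sigma>\<close>, with the same multiplicities.\<close>

locale lift_average =
  fixes m M :: nat
    and lift :: "(nat \<Rightarrow> nat) set \<Rightarrow> ((nat \<Rightarrow> nat) \<Rightarrow> 'p) \<Rightarrow> bool"
    and E :: "(nat \<Rightarrow> nat) set \<Rightarrow> (((nat \<Rightarrow> nat) \<Rightarrow> 'p) \<Rightarrow> real) \<Rightarrow> real"
  assumes cong: "small m M \<sigma> \<Longrightarrow> (\<And>s. lift \<sigma> s \<Longrightarrow> g s = g' s) \<Longrightarrow> E \<sigma> g = E \<sigma> g'"
    and restrict: "small m M \<sigma> \<Longrightarrow> \<tau> \<subseteq> \<sigma> \<Longrightarrow>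
      (\<And>s s'. (\<And>v. v \<in> \<tau> \<Longrightarrow> s v = s' v) \<Longrightarrow> g s = g s') \<Longrightarrow> E \<sigma> g = E \<tau> g"
    and add: "small m M \<sigma> \<Longrightarrow> E \<sigma> (\<lambda>s. g s + g' s) = E \<sigma> g + E \<sigma> g'"
    and scale: "small m M \<sigma> \<Longrightarrow> E \<sigma> (\<lambda>s. c * g s) = c * E \<sigma> g"
    and one: "small m M \<sigma> \<Longrightarrow> E \<sigma> (\<lambda>_. 1) = 1"
begin

lemma zero: "small m M \<sigma> \<Longrightarrow> E \<sigma> (\<lambda>_. 0) = 0"
  using scale[of \<sigma> 0 "\<lambda>_. 0"] by simp

lemma diff: "small m M \<sigma> \<Longrightarrow> E \<sigma> (\<lambda>s. g s - g' s) = E \<sigma> g - E \<sigma> g'"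
  using add[of \<sigma> g "\<lambda>s. - 1 * g' s"] scale[of \<sigma> "-1" g'] by simp

lemma sum:
  assumes "small m M \<sigma>" "finite I"
  shows "E \<sigma> (\<lambda>s. \<Sum>i\<in>I. g i s) = (\<Sum>i\<in>I. E \<sigma> (g i))"
  using assms(2) by induction (simp_all add: zero add assms(1))

text \<open>The bound by \<open>M\<close> collapses the directions below \<open>m\<close> in which
  \<open>p\<close> already has the value \<open>M\<close>, so the same formula serves the cubes of
  the lower-dimensional faces.\<close>

definition cell :: "(nat \<Rightarrow> nat) \<Rightarrow> (nat \<Rightarrow> nat) set" where
  "cell p = {v. (\<forall>i. p i \<le> v i \<and> v i \<le> Suc (p i)) \<and> (\<forall>i<m. v i \<le> M)}"

text \<open>Base points of the cubes that tile the face whose first \<open>j\<close> coordinates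
  equal \<open>M\<close>; for \<open>j = m\<close> only one vertex is left.\<close>

definition corners :: "nat \<Rightarrow> (nat \<Rightarrow> nat) set" where
  "corners j = {p. (\<forall>i<j. p i = M) \<and> (\<forall>i. j \<le> i \<and> i < m \<longrightarrow> p i < M) \<and> (\<forall>i\<ge>m. p i = 0)}"

lemma small_cell: "small m M (cell p)"
proof -
  have "v i \<le> Suc (v' i)" if "v \<in> cell p" "v' \<in> cell p" for v v' i
  proof -
    have "v i \<le> Suc (p i)" "p i \<le> v' i" using that by (auto simp: cell_def)
    then show ?thesis by simp
  qed
  then show ?thesis by (simp add: small_def cell_def)
qed

text \<open>The averaged cup product on the fundamental chain of that face;
  \<open>sign \<pi>\<close> orients the Kuhn simplices.\<close>

definition degree :: "(nat \<Rightarrow> 'p \<Rightarrow> real) \<Rightarrow> nat \<Rightarrow> real" where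
  "degree u j = (\<Sum>p\<in>corners j. E (cell p)
     (\<lambda>s. \<Sum>\<pi> | \<pi> permutes {j..<m}. of_int (sign \<pi>) * cup j m (\<lambda>i v. u i (s v)) p \<pi>))"

context
  fixes u :: "nat \<Rightarrow> 'p \<Rightarrow> real"
  assumes u0: "\<And>\<sigma> s v i. small m M \<sigma> \<Longrightarrow> lift \<sigma> s \<Longrightarrow> v \<in> \<sigma> \<Longrightarrow> i < m \<Longrightarrow> v i = 0 \<Longrightarrow> u i (s v) = 0"
    and u1: "\<And>\<sigma> s v i. small m M \<sigma> \<Longrightarrow> lift \<sigma> s \<Longrightarrow> v \<in> \<sigma> \<Longrightarrow> i < m \<Longrightarrow> v i = M \<Longrightarrow> u i (s v) = 1"
    and M: "M \<ge> 1"
begin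

text \<open>Discrete Stokes formula: telescoping in the direction \<open>\<pi> j\<close> leaves
  pairs of opposite facets. In a direction \<open>h\<close> other than \<open>j\<close> the function
  \<open>u h\<close> is constant on each facet, which kills the factor \<open>h\<close>. In
  direction \<open>j\<close> the facet at 0 is killed by the value 0 of \<open>u j\<close>, and the
  facet at \<open>M\<close>, where \<open>u j\<close> is 1, leaves the cup product of the next
  face.\<close>

lemma degree_Suc:
  assumes j: "j < m"
  shows "degree u j = degree u (Suc j)"
proof -
  define y where "y s i v = u i (s v)" for s :: "(nat \<Rightarrow> nat) \<Rightarrow> 'p" and i v
  define c where "c q \<pi> s = y s j q * cup (Suc j) m (y s) q \<pi>" for q \<pi> s
  define face where "face h q = {v \<in> cell q. v h = q h}" for h q
  \<comment> \<open>Averaging over the facet instead of a cell makes the term depend on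
    \<open>q\<close> and \<open>\<pi>\<close> only: a facet shared by two cells yields the same
    value from both sides.\<close>
  define \<Phi> where "\<Phi> \<pi> q = E (face (\<pi> j) q) (c q \<pi>)" for \<pi> q
  let ?perms = "{\<pi>. \<pi> permutes {j..<m}}"
  have fin: "finite ?perms" by (simp add: finite_permutations)
  have small_face: "small m M (face h q)" for h q
    by (rule small_subset[OF small_cell]) (auto simp: face_def)
  have vertices: "q \<in> face (\<pi> j) q" "\<And>A. A \<subseteq> \<pi> ` {Suc j..<m} \<Longrightarrow> step q A \<in> face (\<pi> j) q"
    if \<pi>: "\<pi> permutes {j..<m}" and q: "\<And>i. i < m \<Longrightarrow> q i \<le> M" "\<And>i. i \<in> {j..<m} \<Longrightarrow> i \<noteq> \<pi> j \<Longrightarrow> q i < M"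
    for \<pi> q
  proof -
    show "q \<in> face (\<pi> j) q"
      using q(1) by (simp add: face_def cell_def)
    fix A assume A: "A \<subseteq> \<pi> ` {Suc j..<m}"
    have "inj \<pi>" using \<pi> by (simp add: permutes_inj)
    then have "\<pi> j \<notin> \<pi> ` {Suc j..<m}" by (simp add: inj_image_mem_iff)
    then have nj: "\<pi> j \<notin> A" using A by blast
    moreover have "A \<subseteq> {j..<m}"
      using A permutes_image[OF \<pi>] j by fastforce
    ultimately have "q i < M" if "i \<in> A" for i
      using q(2)[of i] that nj by blast
    then show "step q A \<in> face (\<pi> j) q"
      using q(1) nj by (auto simp: face_def cell_def step_def Suc_le_eq)
  qed
  have local: "c q \<pi> s = c q \<pi> s'"
    if "\<pi> permutes {j..<m}" "\<And>i. i < m \<Longrightarrow> q i \<le> M" "\<And>i. i \<in> {j..<m} \<Longrightarrow> i \<noteq> \<pi> j \<Longrightarrow> q i < M"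
      and eq: "\<And>v. v \<in> face (\<pi> j) q \<Longrightarrow> s v = s' v" for \<pi> q s s'
  proof -
    note V = vertices[OF that(1-3)]
    have "cup (Suc j) m (y s) q \<pi> = cup (Suc j) m (y s') q \<pi>"
      unfolding cup_def
    proof (rule prod.cong[OF refl])
      fix i assume "i \<in> {Suc j..<m}"
      then have "step q (\<pi> ` {Suc j..i}) \<in> face (\<pi> j) q" "step q (\<pi> ` {Suc j..<i}) \<in> face (\<pi> j) q"
        by (auto intro!: V(2) image_mono)
      then show "y s i (step q (\<pi> ` {Suc j..i})) - y s i (step q (\<pi> ` {Suc j..<i})) =
        y s' i (step q (\<pi> ` {Suc j..i})) - y s' i (step q (\<pi> ` {Suc j..<i}))"
        by (simp add: y_def eq)
    qed
    then show ?thesis using eq[OF V(1)] by (simp add: c_def y_def)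
  qed
  have corner: "\<And>i. i < m \<Longrightarrow> p i \<le> M" "\<And>i. i \<in> {j..<m} \<Longrightarrow> p i < M" if "p \<in> corners j" for p
  proof -
    show "p i \<le> M" if "i < m" for i
      using \<open>p \<in> corners j\<close> that by (cases "i < j") (auto simp: corners_def intro: less_imp_le)
    show "p i < M" if "i \<in> {j..<m}" for i
      using \<open>p \<in> corners j\<close> that by (auto simp: corners_def)
  qed
  have perm_j: "\<pi> j \<in> {j..<m}" if "\<pi> permutes {j..<m}" for \<pi>
    using permutes_in_image[OF that] j by auto
  have "degree u j = (\<Sum>p\<in>corners j. \<Sum>\<pi>\<in>?perms. of_int (sign \<pi>) * (\<Phi> \<pi> (step p {\<pi> j}) - \<Phi> \<pi> p))"
    unfolding degree_def
  proof (rule sum.cong[OF refl])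
    fix p assume p: "p \<in> corners j"
    have "E (cell p) (\<lambda>s. \<Sum>\<pi>\<in>?perms. of_int (sign \<pi>) * cup j m (\<lambda>i v. u i (s v)) p \<pi>)
        = E (cell p) (\<lambda>s. \<Sum>\<pi>\<in>?perms. of_int (sign \<pi>) * (c (step p {\<pi> j}) \<pi> s - c p \<pi> s))"
      unfolding c_def sum_cup_expand[OF j] y_def by simp
    also have "\<dots> = (\<Sum>\<pi>\<in>?perms. of_int (sign \<pi>) * (E (cell p) (c (step p {\<pi> j}) \<pi>) - E (cell p) (c p \<pi>)))"
      by (simp add: sum[OF small_cell fin] scale[OF small_cell] diff[OF small_cell])
    also have "\<dots> = (\<Sum>\<pi>\<in>?perms. of_int (sign \<pi>) * (\<Phi> \<pi> (step p {\<pi> j}) - \<Phi> \<pi> p))"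
    proof (rule sum.cong[OF refl])
      fix \<pi> assume "\<pi> \<in> ?perms"
      then have \<pi>: "\<pi> permutes {j..<m}" by simp
      have h: "p (\<pi> j) < M" using corner(2)[OF p] perm_j[OF \<pi>] by blast
      have "E (cell p) (c p \<pi>) = \<Phi> \<pi> p"
        unfolding \<Phi>_def
        by (intro restrict small_cell local \<pi>) (use corner[OF p] in \<open>auto simp: face_def\<close>)
      moreover have "E (cell p) (c (step p {\<pi> j}) \<pi>) = \<Phi> \<pi> (step p {\<pi> j})"
        unfolding \<Phi>_def
      proof (intro restrict small_cell local \<pi>)
        show "face (\<pi> j) (step p {\<pi> j}) \<subseteq> cell p"
        proof
          fix v assume v: "v \<in> face (\<pi> j) (step p {\<pi> j})"
          then have *: "step p {\<pi> j} i \<le> v i \<and> v i \<le> Suc (step p {\<pi> j} i)" "v (\<pi> j) = Suc (p (\<pi> j))" for i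
            by (auto simp: face_def cell_def step_def)
          have "p i \<le> v i \<and> v i \<le> Suc (p i)" for i
            using *(1)[of i] *(2) by (cases "i = \<pi> j") (auto simp: step_def)
          then show "v \<in> cell p" using v by (auto simp: face_def cell_def)
        qed
      next
        fix i assume "i < m"
        then show "step p {\<pi> j} i \<le> M"
          using corner[OF p] h by (auto simp: step_def)
      next
        fix i assume "i \<in> {j..<m}" "i \<noteq> \<pi> j"
        then show "step p {\<pi> j} i < M"
          using corner[OF p] by (auto simp: step_def)
      qed
      ultimately show "of_int (sign \<pi>) * (E (cell p) (c (step p {\<pi> j}) \<pi>) - E (cell p) (c p \<pi>))
        = of_int (sign \<pi>) * (\<Phi> \<pi> (step p {\<pi> j}) - \<Phi> \<pi> p)" by simp
    qed
    finally show "E (cell p) (\<lambda>s. \<Sum>\<pi>\<in>?perms. of_int (sign \<pi>) * cup j m (\<lambda>i v. u i (s v)) p \<pi>)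
      = (\<Sum>\<pi>\<in>?perms. of_int (sign \<pi>) * (\<Phi> \<pi> (step p {\<pi> j}) - \<Phi> \<pi> p))" .
  qed
  also have "\<dots> = (\<Sum>\<pi>\<in>?perms. of_int (sign \<pi>) * (\<Sum>p\<in>corners j. \<Phi> \<pi> (step p {\<pi> j}) - \<Phi> \<pi> p))"
    by (subst sum.swap) (simp add: sum_distrib_left)
  also have "\<dots> = (\<Sum>\<pi>\<in>?perms. of_int (sign \<pi>) *
       (\<Sum>p | p \<in> corners j \<and> p (\<pi> j) = 0. \<Phi> \<pi> (p(\<pi> j := M)) - \<Phi> \<pi> p))"
  proof (rule sum.cong[OF refl])
    fix \<pi> assume "\<pi> \<in> ?perms"
    then have "\<pi> j \<in> {j..<m}" using perm_j by simp
    then have "(\<Sum>p\<in>corners j. \<Phi> \<pi> (step p {\<pi> j}) - \<Phi> \<pi> p) =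
      (\<Sum>p | p \<in> corners j \<and> p (\<pi> j) = 0. \<Phi> \<pi> (p(\<pi> j := M)) - \<Phi> \<pi> p)"
      by (intro sum_telescope_coordinate) (auto simp: corners_def)
    then show "of_int (sign \<pi>) * (\<Sum>p\<in>corners j. \<Phi> \<pi> (step p {\<pi> j}) - \<Phi> \<pi> p) =
      of_int (sign \<pi>) * (\<Sum>p | p \<in> corners j \<and> p (\<pi> j) = 0. \<Phi> \<pi> (p(\<pi> j := M)) - \<Phi> \<pi> p)"
      by simp
  qed
  also have "\<dots> = (\<Sum>\<pi>\<in>?perms. if \<pi> j = j then of_int (sign \<pi>) *
       (\<Sum>q\<in>corners (Suc j). E (cell q) (\<lambda>s. cup (Suc j) m (y s) q \<pi>)) else 0)"
  proof (rule sum.cong[OF refl])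
    fix \<pi> assume "\<pi> \<in> ?perms"
    then have \<pi>: "\<pi> permutes {j..<m}" by simp
    show "of_int (sign \<pi>) * (\<Sum>p | p \<in> corners j \<and> p (\<pi> j) = 0. \<Phi> \<pi> (p(\<pi> j := M)) - \<Phi> \<pi> p) =
      (if \<pi> j = j then of_int (sign \<pi>) *
       (\<Sum>q\<in>corners (Suc j). E (cell q) (\<lambda>s. cup (Suc j) m (y s) q \<pi>)) else 0)"
    proof (cases "\<pi> j = j")
      case False
      define h where "h = \<pi> j"
      have h: "h \<in> {Suc j..<m}" using False perm_j[OF \<pi>] by (simp add: h_def)
      have "\<Phi> \<pi> q = 0"
        if q: "\<And>i. i < m \<Longrightarrow> q i \<le> M" "\<And>i. i \<in> {j..<m} \<Longrightarrow> i \<noteq> \<pi> j \<Longrightarrow> q i < M" "q h = 0 \<or> q h = M" for q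
      proof -
        have "\<Phi> \<pi> q = E (face (\<pi> j) q) (\<lambda>_. 0)"
          unfolding \<Phi>_def
        proof (rule cong[OF small_face])
          fix s assume s: "lift (face (\<pi> j) q) s"
          have *: "y s h v = (if q h = 0 then 0 else 1)" if "v \<in> face (\<pi> j) q" for v
            using u0[OF small_face s that, of h] u1[OF small_face s that, of h] q(3) h that
            by (auto simp: y_def face_def h_def)
          have "step q (\<pi> ` {Suc j..h}) \<in> face (\<pi> j) q" "step q (\<pi> ` {Suc j..<h}) \<in> face (\<pi> j) q"
            using h by (auto intro!: vertices(2)[OF \<pi> q(1,2)] image_mono)
          then have "y s h (step q (\<pi> ` {Suc j..h})) - y s h (step q (\<pi> ` {Suc j..<h})) = 0"
            by (simp add: *)
          then have "cup (Suc j) m (y s) q \<pi> = 0"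
            unfolding cup_def using h by (auto intro!: prod_zero)
          then show "c q \<pi> s = 0" by (simp add: c_def)
        qed
        then show ?thesis by (simp add: zero small_face)
      qed
      then have "\<Phi> \<pi> (p(\<pi> j := M)) - \<Phi> \<pi> p = 0" if "p \<in> corners j" "p (\<pi> j) = 0" for p
        using corner[OF that(1)] that(2) by (simp add: h_def)
      then show ?thesis using False by simp
    next
      case True
      have zero: "\<Phi> \<pi> p = 0" if "p \<in> corners j" "p j = 0" for p
      proof -
        have "\<Phi> \<pi> p = E (face (\<pi> j) p) (\<lambda>_. 0)"
          unfolding \<Phi>_def
        proof (rule cong[OF small_face])
          fix s assume s: "lift (face (\<pi> j) p) s"
          have "p \<in> face (\<pi> j) p" using vertices(1)[OF \<pi>] corner[OF that(1)] by blast
          then show "c p \<pi> s = 0"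
            using u0[OF small_face s _ j] that by (simp add: c_def y_def)
        qed
        then show ?thesis by (simp add: lift_average.zero[OF lift_average_axioms] small_face)
      qed
      have top: "\<Phi> \<pi> q = E (cell q) (\<lambda>s. cup (Suc j) m (y s) q \<pi>)" if q: "q \<in> corners (Suc j)" for q
      proof -
        have qj: "q j = M" using q by (simp add: corners_def)
        have "face (\<pi> j) q = cell q"
          using qj j unfolding True face_def cell_def by (auto intro: antisym) 
        moreover have "q \<in> cell q"
        proof -
          have "q i \<le> M" if "i < m" for i
            using q that by (cases "i < Suc j") (auto simp: corners_def intro: less_imp_le)
          then show ?thesis by (simp add: cell_def)
        qed
        moreover have "E (cell q) (c q \<pi>) = E (cell q) (\<lambda>s. cup (Suc j) m (y s) q \<pi>)"
        proof (rule cong[OF small_cell])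
          fix s assume "lift (cell q) s"
          then have "u j (s q) = 1"
            using u1[OF small_cell, of q s q j] j qj \<open>q \<in> cell q\<close> by simp
          then show "c q \<pi> s = cup (Suc j) m (y s) q \<pi>"
            by (simp add: c_def y_def)
        qed
        ultimately show ?thesis
          unfolding \<Phi>_def by simp
      qed
      have "(\<Sum>p | p \<in> corners j \<and> p j = 0. \<Phi> \<pi> (p(j := M)) - \<Phi> \<pi> p)
          = (\<Sum>p | p \<in> corners j \<and> p j = 0. \<Phi> \<pi> (p(j := M)))"
        using zero by simp
      also have "\<dots> = (\<Sum>q\<in>corners (Suc j). \<Phi> \<pi> q)"
      proof (rule sum.reindex_bij_witness[where i="\<lambda>q. q(j := 0)" and j="\<lambda>p. p(j := M)"])
        fix q assume "q \<in> corners (Suc j)"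
        then show "q(j := 0) \<in> {p \<in> corners j. p j = 0}" "q(j := 0, j := M) = q"
          using M by (auto simp: corners_def)
      next
        fix p assume "p \<in> {p \<in> corners j. p j = 0}"
        then show "p(j := M) \<in> corners (Suc j)" "p(j := M, j := 0) = p"
          using j by (auto simp: corners_def less_Suc_eq)
      qed auto
      finally show ?thesis using True top by simp
    qed
  qed
  also have "\<dots> = (\<Sum>\<pi> | \<pi> permutes {Suc j..<m}. of_int (sign \<pi>) *
       (\<Sum>q\<in>corners (Suc j). E (cell q) (\<lambda>s. cup (Suc j) m (y s) q \<pi>)))"
  proof -
    have "{\<pi> \<in> ?perms. \<pi> j = j} = {\<pi>. \<pi> permutes {Suc j..<m}}"
    proof (intro Collect_cong iffI set_eqI; clarsimp)
      fix \<pi> assume "\<pi> permutes {j..<m}" "\<pi> j = j"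
      then show "\<pi> permutes {Suc j..<m}"
        by (elim permutes_superset) (auto simp: le_less Suc_le_eq)
    next
      fix \<pi> assume "\<pi> permutes {Suc j..<m}"
      then show "\<pi> permutes {j..<m} \<and> \<pi> j = j"
        by (auto intro: permutes_subset simp: permutes_not_in)
    qed
    then show ?thesis
      by (simp add: sum.inter_filter[symmetric] fin)
  qed
  also have "\<dots> = degree u (Suc j)"
    unfolding degree_def y_def
    by (simp add: sum[OF small_cell] finite_permutations scale[OF small_cell] sum_distrib_left)
       (rule sum.swap)
  finally show ?thesis .
qed

text \<open>At \<open>j = m\<close> the face is one vertex and the cup product is empty, hence
  1.\<close>

lemma degree_eq_1: "degree u 0 = 1"
proof -
  have "degree u 0 = degree u j" if "j \<le> m" for j
    using that by (induction j) (simp_all add: degree_Suc)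
  from this[of m] have "degree u 0 = degree u m" by simp
  also have "corners m = {\<lambda>i. if i < m then M else 0}"
    by (auto simp: corners_def fun_eq_iff)
  then have "degree u m = 1"
    by (simp add: degree_def cup_def one small_cell)
  finally show ?thesis .
qed

text \<open>A Sperner-type statement: if every lift of every cell had some constant
  \<open>u i\<close>, each cup product would contain a zero factor and the degree would be
  0.\<close>

lemma exists_complete_lift:
  obtains \<sigma> s where "small m M \<sigma>" "lift \<sigma> s"
    "\<And>i. i < m \<Longrightarrow> \<exists>v\<in>\<sigma>. \<exists>v'\<in>\<sigma>. u i (s v) \<noteq> u i (s v')"
proof (rule ccontr)
  assume *: "\<not> thesis"
  note A = that
  have "degree u 0 = (\<Sum>p\<in>corners 0. 0)"
    unfolding degree_def
  proof (rule sum.cong[OF refl])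
    fix p assume p: "p \<in> corners 0"
    have mem: "step p A \<in> cell p" if "A \<subseteq> {0..<m}" for A
    proof -
      have "p i < M" if "i < m" for i using p that by (simp add: corners_def)
      moreover have "i < m" if "i \<in> A" for i using \<open>A \<subseteq> {0..<m}\<close> that by auto
      ultimately show ?thesis by (simp add: cell_def step_def Suc_le_eq less_imp_le)
    qed
    have "E (cell p) (\<lambda>s. \<Sum>\<pi> | \<pi> permutes {0..<m}. of_int (sign \<pi>) * cup 0 m (\<lambda>i v. u i (s v)) p \<pi>)
        = E (cell p) (\<lambda>_. 0)"
    proof (rule cong[OF small_cell])
      fix s assume s: "lift (cell p) s"
      obtain i where i: "i < m" "\<And>v v'. v \<in> cell p \<Longrightarrow> v' \<in> cell p \<Longrightarrow> u i (s v) = u i (s v')"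
      proof -
        have "\<not> (\<forall>i<m. \<exists>v\<in>cell p. \<exists>v'\<in>cell p. u i (s v) \<noteq> u i (s v'))"
        proof
          assume "\<forall>i<m. \<exists>v\<in>cell p. \<exists>v'\<in>cell p. u i (s v) \<noteq> u i (s v')"
          then have "\<And>i. i < m \<Longrightarrow> \<exists>v\<in>cell p. \<exists>v'\<in>cell p. u i (s v) \<noteq> u i (s v')" by blast
          with A[OF small_cell s] * show False by blast
        qed
        with that show ?thesis by blast
      qed
      have "cup 0 m (\<lambda>i v. u i (s v)) p \<pi> = 0" if \<pi>: "\<pi> permutes {0..<m}" for \<pi>
      proof -
        have "\<pi> ` {0..i} \<subseteq> \<pi> ` {0..<m}" "\<pi> ` {0..<i} \<subseteq> \<pi> ` {0..<m}"
          using i(1) by (intro image_mono; auto)+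
        then have "\<pi> ` {0..i} \<subseteq> {0..<m}" "\<pi> ` {0..<i} \<subseteq> {0..<m}"
          by (simp_all only: permutes_image[OF \<pi>])
        from i(2)[OF this[THEN mem]]
        have "u i (s (step p (\<pi> ` {0..i}))) - u i (s (step p (\<pi> ` {0..<i}))) = 0"
          by simp
        then show ?thesis
          unfolding cup_def using i(1) by (intro prod_zero bexI[of _ i]) simp_all
      qed
      then show "(\<Sum>\<pi> | \<pi> permutes {0..<m}. of_int (sign \<pi>) * cup 0 m (\<lambda>i v. u i (s v)) p \<pi>) = 0"
        by (intro sum.neutral) simp
    qed
    then show "E (cell p) (\<lambda>s. \<Sum>\<pi> | \<pi> permutes {0..<m}. of_int (sign \<pi>) * cup 0 m (\<lambda>i v. u i (s v)) p \<pi>) = 0"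
      by (simp add: zero small_cell)
  qed
  then show False using degree_eq_1 by simp
qed

end

end

subsection \<open>Towers of root extensions\<close>

lemma dist_fun_less:
  fixes \<epsilon> :: real
  assumes "\<epsilon> > 0"
  obtains \<rho> N where "\<rho> > 0" "\<forall>w w' :: nat \<Rightarrow> real. (\<forall>i<N. \<bar>w i - w' i\<bar> < \<rho>) \<longrightarrow> dist w w' < \<epsilon>"
proof -
  obtain L where L: "(1/2) ^ L < \<epsilon> / 2"
    using real_arch_pow_inv[of "\<epsilon>/2" "1/2"] assms by auto
  \<comment> \<open>The metric on functions weights coordinates along \<open>from_nat\<close>, so
    \<open>N\<close> passes all indices of the first \<open>L + 1\<close> terms. They cost at most
    twice \<open>\<epsilon> / 4\<close>, the tail less than \<open>\<epsilon> / 2\<close>.\<close>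
  define N where "N = Suc (Max ((from_nat :: nat \<Rightarrow> nat) ` {..L}))"
  have "dist w w' < \<epsilon>" if close: "\<And>i. i < N \<Longrightarrow> \<bar>w i - w' i\<bar> < \<epsilon> / 4" for w w' :: "nat \<Rightarrow> real"
  proof -
    have "dist (w (from_nat l)) (w' (from_nat l)) \<le> \<epsilon> / 4" if "l \<le> L" for l
    proof -
      have "from_nat l < N"
        using that by (simp add: N_def less_Suc_eq_le)
      from close[OF this] show ?thesis by (simp add: dist_real_def)
    qed
    then have "Max {dist (w (from_nat l)) (w' (from_nat l)) |l. l \<le> L} \<le> \<epsilon> / 4"
      by (intro Max.boundedI) auto
    with dist_fun_le_dist_first_terms[of w w' L] L show ?thesis by linarith
  qed
  then show thesis using that[of "\<epsilon>/4" N] assms by simp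
qed

definition unit_box :: "(nat \<Rightarrow> real) set" where
  "unit_box = {w. \<forall>i. \<bar>w i\<bar> \<le> 1}"

lemma compact_unit_box: "compact unit_box"
proof -
  have "compactin (product_topology (\<lambda>i. euclidean) UNIV) (PiE UNIV (\<lambda>i::nat. {-1..1::real}))"
    by (subst compactin_PiE) simp
  moreover have "PiE UNIV (\<lambda>i::nat. {-1..1::real}) = unit_box"
    by (auto simp: unit_box_def PiE_UNIV_domain abs_le_iff Pi_iff)
  ultimately show ?thesis
    by (simp add: euclidean_product_topology)
qed

lemma continuous_on_coordinate: "continuous_on S (\<lambda>w::nat \<Rightarrow> real. w i)"
  by (rule continuous_on_subset[OF continuous_on_product_coordinates subset_UNIV])

text \<open>The principal branch, with root 0 at 0. It jumps across the negative axis, so continuity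
  is used only near 1, for quotients of nearby values.\<close>

definition croot :: "nat \<Rightarrow> complex \<Rightarrow> complex" where
  "croot n w = w powr (1 / of_nat n)"

lemma croot_power:
  assumes "n \<ge> 1"
  shows "croot n w ^ n = w"
proof (cases "w = 0")
  case True
  then show ?thesis using assms by (simp add: croot_def power_0_left)
next
  case False
  have "croot n w ^ n = exp (of_nat n * (1 / of_nat n * Ln w))"
    using False by (simp only: croot_def powr_def exp_of_nat_mult if_False)
  also have "\<dots> = w" using assms False by simp
  finally show ?thesis .
qed

text \<open>In the right half-plane the arguments lie within \<open>pi / 2\<close> of 0, so their
  sum does not wrap around. This is what compares branches with different reference
  vertices.\<close>

lemma croot_mult:
  assumes "Re a > 0" "Re b > 0"
  shows "croot n (a * b) = croot n a * croot n b"
proof -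
  have nz: "a \<noteq> 0" "b \<noteq> 0" using assms by auto
  have "\<bar>Im (Ln a)\<bar> < pi/2" "\<bar>Im (Ln b)\<bar> < pi/2"
    using assms Re_Ln_pos_lt nz by blast+
  then have "Ln (a * b) = Ln a + Ln b"
    by (intro Ln_times_simple nz) (auto simp: abs_if split: if_splits)
  then show ?thesis
    using nz by (simp add: croot_def powr_def exp_add[symmetric] add_divide_distrib)
qed

lemma croot_near_1:
  assumes "\<epsilon> > 0"
  obtains \<delta> where "\<delta> > 0" "\<delta> < 1" "\<And>q. norm (q - 1) < \<delta> \<Longrightarrow> norm (croot n q - 1) < \<epsilon>"
proof -
  have "isCont (croot n) 1"
    unfolding croot_def by (intro continuous_intros) (auto simp: complex_nonpos_Reals_iff)
  then obtain d where d: "d > 0" "\<And>q. dist q 1 < d \<Longrightarrow> dist (croot n q) (croot n 1) < \<epsilon>"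
    using assms unfolding continuous_at_eps_delta by blast
  have "croot n 1 = 1" by (simp add: croot_def)
  then show thesis
    using d by (intro that[of "min d (1/2)"]) (auto simp: dist_norm)
qed

section \<open>The tower as an intersection of closed subsets of a cube of real sequences\<close>

definition coord :: "nat \<Rightarrow> (nat \<Rightarrow> real) \<Rightarrow> complex" where
  "coord k w = Complex (w (2 * k)) (w (2 * k + 1))"

definition set_coord :: "nat \<Rightarrow> complex \<Rightarrow> (nat \<Rightarrow> real) \<Rightarrow> nat \<Rightarrow> real" where
  "set_coord k t w = w(2 * k := Re t, 2 * k + 1 := Im t)"

lemma coord_set_coord [simp]: "coord k (set_coord k t w) = t"
  by (simp add: coord_def set_coord_def)

lemma set_coord_less [simp]: "i < 2 * k \<Longrightarrow> set_coord k t w i = w i"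
  by (simp add: set_coord_def)

lemma continuous_on_coord: "continuous_on S (coord k)"
  unfolding coord_def Complex_eq by (intro continuous_intros continuous_on_coordinate)

text \<open>Complex coordinate \<open>k\<close> occupies the real slots \<open>2 * k\<close> and
  \<open>2 * k + 1\<close>, so \<open>f_dep\<close> lets \<open>f k\<close> see earlier coordinates
  only. The bound \<open>f_le\<close> keeps all roots in the unit disc and hence the tower in
  \<open>unit_box\<close>.\<close>

locale root_tower =
  fixes m :: nat and n :: "nat \<Rightarrow> nat" and f :: "nat \<Rightarrow> (nat \<Rightarrow> real) \<Rightarrow> complex"
  assumes n: "n k \<ge> 1"
    and f_cont: "continuous_on UNIV (f k)"
    and f_le: "norm (f k w) \<le> 1"
    and f_dep: "(\<And>i. i < 2 * k \<Longrightarrow> w i = w' i) \<Longrightarrow> f k w = f k w'"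
begin

lemma f_uniform:
  assumes "\<kappa> > 0"
  obtains \<rho> where "\<rho> > 0" "\<forall>w\<in>unit_box. \<forall>w'\<in>unit_box.
      (\<forall>i<2 * k. \<bar>w i - w' i\<bar> < \<rho>) \<longrightarrow> norm (f k w - f k w') < \<kappa>"
proof -
  have "uniformly_continuous_on unit_box (f k)"
    using compact_uniformly_continuous compact_unit_box continuous_on_subset f_cont subset_UNIV by blast
  then obtain d where d: "d > 0" "\<And>w w'. w \<in> unit_box \<Longrightarrow> w' \<in> unit_box \<Longrightarrow> dist w w' < d \<Longrightarrow> dist (f k w) (f k w') < \<kappa>"
    unfolding uniformly_continuous_on_def using assms by metis
  obtain \<rho> N where N: "\<rho> > 0" "\<forall>w w' :: nat \<Rightarrow> real. (\<forall>i<N. \<bar>w i - w' i\<bar> < \<rho>) \<longrightarrow> dist w w' < d"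
    by (rule dist_fun_less[OF d(1)])
  \<comment> \<open>Zero padding turns closeness of the first \<open>2 * k\<close> coordinates into
    closeness of all of them without changing \<open>f k\<close>.\<close>
  define t where "t w i = (if i < 2 * k then w i else 0)" for w :: "nat \<Rightarrow> real" and i
  have "norm (f k w - f k w') < \<kappa>"
    if "w \<in> unit_box" "w' \<in> unit_box" "\<And>i. i < 2 * k \<Longrightarrow> \<bar>w i - w' i\<bar> < \<rho>" for w w'
  proof -
    have "dist (f k (t w)) (f k (t w')) < \<kappa>"
      using that by (intro d(2) N(2)[rule_format]) (auto simp: t_def unit_box_def N(1))
    moreover have "f k (t w) = f k w" "f k (t w') = f k w'"
      by (intro f_dep; simp add: t_def)+
    ultimately show ?thesis by (simp add: dist_norm)
  qed
  then show thesis using that N(1) by blast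
qed

text \<open>For \<open>k \<ge> m\<close> this is the cylinder over the extension built up to level
  \<open>k\<close>: later slots range freely over the box. Thus the inverse limit becomes an
  intersection, without bonding maps.\<close>

definition stage :: "nat \<Rightarrow> (nat \<Rightarrow> real) set" where
  "stage k = {w \<in> unit_box. (\<forall>i<m. 0 \<le> w (2 * i) \<and> w (2 * i + 1) = 0) \<and>
     (\<forall>j. m \<le> j \<and> j < k \<longrightarrow> coord j w ^ n j = f j w)}"

definition tower :: "(nat \<Rightarrow> real) set" where
  "tower = (\<Inter>k. stage k)"

lemma stage_Suc:
  assumes w: "w \<in> stage k" and k: "k \<ge> m" and t: "t ^ n k = f k w"
  shows "set_coord k t w \<in> stage (Suc k)"
proof -
  have "norm t ^ n k \<le> 1"
    using f_le[of k w] t by (metis norm_power)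
  then have "norm t \<le> 1"
    using n[of k] by (metis less_one linorder_not_le norm_ge_zero one_less_power zero_less_iff_neq_zero not_one_le_zero)
  then have "\<bar>Re t\<bar> \<le> 1" "\<bar>Im t\<bar> \<le> 1"
    using abs_Re_le_cmod[of t] abs_Im_le_cmod[of t] by linarith+
  moreover have "f j (set_coord k t w) = f j w" if "j \<le> k" for j
    using that by (intro f_dep) auto
  moreover have "coord j (set_coord k t w) = coord j w" if "j < k" for j
    using that by (simp add: coord_def)
  ultimately show ?thesis
    using w k t by (auto simp: stage_def unit_box_def less_Suc_eq) (auto simp: set_coord_def)
qed

lemma stage_extend:
  assumes w: "w \<in> stage k" and k: "k \<ge> m" "k \<ge> 1"
  obtains w' where "w' \<in> tower" "\<And>i. i < 2 * k \<Longrightarrow> w' i = w i"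
proof -
  have "\<exists>W. \<forall>l. (W l \<in> stage (k + l) \<and> (l = 0 \<longrightarrow> W l = w)) \<and> (\<forall>i < 2 * (k + l). W (Suc l) i = W l i)"
  proof (rule dependent_nat_choice)
    show "\<exists>v. v \<in> stage (k + 0) \<and> (0 = (0::nat) \<longrightarrow> v = w)"
      using w by simp
  next
    fix v l assume v: "v \<in> stage (k + l) \<and> (l = 0 \<longrightarrow> v = w)"
    have "croot (n (k + l)) (f (k + l) v) ^ n (k + l) = f (k + l) v"
      by (rule croot_power[OF n])
    then have "set_coord (k + l) (croot (n (k + l)) (f (k + l) v)) v \<in> stage (Suc (k + l))"
      using v k by (intro stage_Suc) auto
    then show "\<exists>v'. (v' \<in> stage (k + Suc l) \<and> (Suc l = 0 \<longrightarrow> v' = w)) \<and> (\<forall>i < 2 * (k + l). v' i = v i)"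
      by (intro exI[of _ "set_coord (k + l) (croot (n (k + l)) (f (k + l) v)) v"]) simp
  qed
  then obtain W where W: "\<And>l. W l \<in> stage (k + l)" "W 0 = w"
    "\<And>l i. i < 2 * (k + l) \<Longrightarrow> W (Suc l) i = W l i"
    by blast
  have stable: "W (l + d) i = W l i" if "i < 2 * (k + l)" for l d i
    using that by (induction d) (simp_all add: W(3))
  \<comment> \<open>The diagonal works because coordinate \<open>i\<close> is settled from step
    \<open>i\<close> on, as \<open>i < 2 * (k + i)\<close>; for \<open>i = 0\<close> this uses
    \<open>k \<ge> 1\<close>.\<close>
  define w' where "w' i = W i i" for i
  have w': "w' i = W l i" if "i < 2 * (k + l)" for i l
  proof (cases "i \<le> l")
    case True
    then show ?thesis using stable[of i i "l - i"] k by (simp add: w'_def)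
  next
    case False
    then show ?thesis using stable[of i l "i - l"] that by (simp add: w'_def)
  qed
  have "w' \<in> stage l" for l
  proof -
    have eq: "w' i = W l i" if "i < 2 * l" for i using w'[of i l] that by simp
    have "coord j w' ^ n j = f j w'" if j: "m \<le> j" "j < l" for j
    proof -
      have "coord j w' = coord j (W l)" "f j w' = f j (W l)"
        using j by (auto simp: coord_def eq intro!: f_dep)
      then show ?thesis using W(1)[of l] j by (simp add: stage_def)
    qed
    moreover have "\<bar>w' i\<bar> \<le> 1" for i
      using W(1)[of i] by (simp add: w'_def stage_def unit_box_def)
    moreover have "0 \<le> w' (2 * i)" "w' (2 * i + 1) = 0" if "i < m" for i
      using w'[of "2*i" 0] w'[of "2*i+1" 0] W(2) w that k by (auto simp: stage_def)
    ultimately show ?thesis by (auto simp: stage_def unit_box_def)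
  qed
  then show thesis
    using that[of w'] w'[of _ 0] W(2) by (simp add: tower_def)
qed

lemma closed_stage: "closed (stage k)"
proof -
  have eq: "stage k = unit_box \<inter> (\<Inter>i<m. {w. 0 \<le> w (2 * i)} \<inter> {w. w (2 * i + 1) = 0}) \<inter>
     (\<Inter>j\<in>{m..<k}. {w. coord j w ^ n j = f j w})"
    by (auto simp: stage_def)
  show ?thesis unfolding eq
    by (intro closed_Int closed_INT ballI compact_imp_closed[OF compact_unit_box]
        closed_Collect_le closed_Collect_eq continuous_intros continuous_on_coordinate continuous_on_coord f_cont)
qed

lemma compact_tower: "compact tower"
proof -
  have "closed tower" unfolding tower_def by (intro closed_INT ballI closed_stage)
  moreover have "tower \<subseteq> unit_box" by (auto simp: tower_def stage_def)
  ultimately show ?thesis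
    using compact_unit_box compact_Int_closed[of unit_box tower] by (simp add: inf.absorb2)
qed

end

subsection \<open>Transfer to the tower\<close>

context root_tower
begin

section \<open>Lifting small vertex sets through one root extension\<close>

definition lifts :: "nat \<Rightarrow> nat \<Rightarrow> real \<Rightarrow> (nat \<Rightarrow> nat) set \<Rightarrow> ((nat \<Rightarrow> nat) \<Rightarrow> nat \<Rightarrow> real) \<Rightarrow> bool" where
  "lifts k M \<rho> \<sigma> s \<longleftrightarrow>
     (\<forall>v\<in>\<sigma>. s v \<in> stage k \<and> (\<forall>i<m. real M * s v (2 * i) = real (v i))) \<and>
     (\<forall>v\<in>\<sigma>. \<forall>v'\<in>\<sigma>. \<forall>i<2 * k. \<bar>s v i - s v' i\<bar> < \<rho>)"

definition far :: "nat \<Rightarrow> real \<Rightarrow> (nat \<Rightarrow> nat) set \<Rightarrow> ((nat \<Rightarrow> nat) \<Rightarrow> nat \<Rightarrow> real) \<Rightarrow> (nat \<Rightarrow> nat) set" where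
  "far k \<eta> \<sigma> s = {v \<in> \<sigma>. \<eta> \<le> norm (f k (s v))}"

text \<open>Over vertices with \<open>\<bar>f\<bar> \<ge> \<eta>\<close> the root is continued from a reference vertex; elsewhere all branches
  share the principal root.\<close>

definition branch :: "nat \<Rightarrow> real \<Rightarrow> (nat \<Rightarrow> nat) set \<Rightarrow> complex \<Rightarrow> ((nat \<Rightarrow> nat) \<Rightarrow> nat \<Rightarrow> real) \<Rightarrow> (nat \<Rightarrow> nat) \<Rightarrow> complex" where
  "branch k \<eta> \<sigma> \<omega> s v =
     (if v \<in> far k \<eta> \<sigma> s
      then (let a = f k (s (SOME v. v \<in> far k \<eta> \<sigma> s)) in
            \<omega> * croot (n k) a * croot (n k) (f k (s v) / a))
      else croot (n k) (f k (s v)))"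

definition extend :: "nat \<Rightarrow> real \<Rightarrow> (nat \<Rightarrow> nat) set \<Rightarrow> complex \<Rightarrow> ((nat \<Rightarrow> nat) \<Rightarrow> nat \<Rightarrow> real) \<Rightarrow> (nat \<Rightarrow> nat) \<Rightarrow> nat \<Rightarrow> real" where
  "extend k \<eta> \<sigma> \<omega> s v = set_coord k (branch k \<eta> \<sigma> \<omega> s v) (s v)"

definition roots_unity :: "nat \<Rightarrow> complex set" where
  "roots_unity k = {\<omega>. \<omega> ^ n k = 1}"

lemma card_roots_unity: "card (roots_unity k) = n k"
  unfolding roots_unity_def using n[of k] by (intro card_roots_unity_eq) simp

lemma some_far: "v \<in> far k \<eta> \<sigma> s \<Longrightarrow> (SOME v. v \<in> far k \<eta> \<sigma> s) \<in> far k \<eta> \<sigma> s"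
  by (rule someI[where P="\<lambda>v. v \<in> far k \<eta> \<sigma> s"])

lemma far_mono: "\<tau> \<subseteq> \<sigma> \<Longrightarrow> far k \<eta> \<tau> s \<subseteq> far k \<eta> \<sigma> s"
  by (auto simp: far_def)

lemma branch_power:
  assumes "\<omega> \<in> roots_unity k" "\<eta> > 0"
  shows "branch k \<eta> \<sigma> \<omega> s v ^ n k = f k (s v)"
proof (cases "v \<in> far k \<eta> \<sigma> s")
  case True
  from some_far[OF this] have "f k (s (SOME v. v \<in> far k \<eta> \<sigma> s)) \<noteq> 0"
    using assms(2) by (auto simp: far_def)
  with True assms(1) show ?thesis
    by (simp add: branch_def Let_def power_mult_distrib croot_power[OF n] roots_unity_def)
qed (simp add: branch_def croot_power[OF n])

text \<open>Needed for the restriction property: the set \<open>far\<close>, and therefore the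
  reference vertex picked by \<open>SOME\<close>, depends on the lift only through its values on
  \<open>\<tau>\<close>.\<close>

lemma branch_local:
  assumes "\<And>v. v \<in> \<tau> \<Longrightarrow> s v = s' v" "v \<in> \<tau>"
  shows "branch k \<eta> \<tau> \<omega> s v = branch k \<eta> \<tau> \<omega> s' v"
proof -
  have far: "far k \<eta> \<tau> s = far k \<eta> \<tau> s'"
    using assms(1) by (auto simp: far_def)
  show ?thesis
  proof (cases "v \<in> far k \<eta> \<tau> s'")
    case True
    from some_far[OF this] have "(SOME v. v \<in> far k \<eta> \<tau> s') \<in> \<tau>" by (simp add: far_def)
    then show ?thesis unfolding branch_def far using assms by simp
  qed (use assms in \<open>simp add: branch_def far\<close>)
qed

lemma ratio_near_1:
  assumes "v \<in> far k \<eta> \<sigma> s" "v' \<in> far k \<eta> \<sigma> s" "\<eta> > 0"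
    and "\<And>v v'. v \<in> \<sigma> \<Longrightarrow> v' \<in> \<sigma> \<Longrightarrow> norm (f k (s v) - f k (s v')) < \<delta> * \<eta>"
  shows "norm (f k (s v) / f k (s v') - 1) < \<delta>"
proof -
  have v': "\<eta> \<le> norm (f k (s v'))" "f k (s v') \<noteq> 0"
    using assms(2,3) by (auto simp: far_def)
  have "0 \<le> norm (f k (s v) - f k (s v'))" by simp
  also have lt: "norm (f k (s v) - f k (s v')) < \<delta> * \<eta>"
    using assms by (auto simp: far_def)
  finally have "\<delta> > 0" using assms(3) by (simp add: zero_less_mult_iff)
  have "norm (f k (s v) / f k (s v') - 1) = norm (f k (s v) - f k (s v')) / norm (f k (s v'))"
    using v'(2) by (simp add: norm_divide[symmetric] diff_divide_distrib)
  also have "\<dots> < \<delta>"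
    using less_le_trans[OF lt mult_left_mono[OF v'(1), of \<delta>]] v'(2) \<open>\<delta> > 0\<close>
    by (simp add: divide_less_eq)
  finally show ?thesis .
qed

text \<open>Passing to a subset changes the reference vertex of the branches, which only permutes them.\<close>

lemma sum_extend_subset:
  assumes \<tau>: "\<tau> \<subseteq> \<sigma>" and \<eta>: "\<eta> > 0" and \<delta>: "\<delta> \<le> 1"
    and near: "\<And>v v'. v \<in> \<sigma> \<Longrightarrow> v' \<in> \<sigma> \<Longrightarrow> norm (f k (s v) - f k (s v')) < \<delta> * \<eta>"
    and local: "\<And>s s'. (\<And>v. v \<in> \<tau> \<Longrightarrow> s v = s' v) \<Longrightarrow> g s = g s'"
  shows "(\<Sum>\<omega>\<in>roots_unity k. g (extend k \<eta> \<sigma> \<omega> s)) = (\<Sum>\<omega>\<in>roots_unity k. g (extend k \<eta> \<tau> \<omega> s))"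
proof (cases "far k \<eta> \<tau> s = {}")
  case True
  have "extend k \<eta> \<sigma> \<omega> s v = extend k \<eta> \<tau> \<omega> s v" if "v \<in> \<tau>" for v \<omega>
    using True that \<tau> by (auto simp: extend_def branch_def far_def)
  then show ?thesis by (intro sum.cong refl local)
next
  case False
  define a where "a = f k (s (SOME v. v \<in> far k \<eta> \<sigma> s))"
  define b where "b = f k (s (SOME v. v \<in> far k \<eta> \<tau> s))"
  define r where "r = croot (n k)"
  have ra: "(SOME v. v \<in> far k \<eta> \<sigma> s) \<in> far k \<eta> \<sigma> s" and rb: "(SOME v. v \<in> far k \<eta> \<tau> s) \<in> far k \<eta> \<tau> s"
    using False far_mono[OF \<tau>] some_far by blast+
  have rb': "(SOME v. v \<in> far k \<eta> \<tau> s) \<in> far k \<eta> \<sigma> s"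
    using rb far_mono[OF \<tau>] by blast
  have nz: "a \<noteq> 0" "b \<noteq> 0"
    using ra rb \<eta> by (auto simp: far_def a_def b_def)
  have pos: "Re (f k (s v) / f k (s v')) > 0" if "v \<in> far k \<eta> \<sigma> s" "v' \<in> far k \<eta> \<sigma> s" for v v'
  proof -
    have "norm (f k (s v) / f k (s v') - 1) < 1"
      using ratio_near_1[OF that \<eta> near] \<delta> by simp
    then show ?thesis
      using abs_Re_le_cmod[of "f k (s v) / f k (s v') - 1"] by simp
  qed
  \<comment> \<open>Both \<open>r a * r (b / a)\<close> and \<open>r b\<close> are roots of
    \<open>b\<close>; their quotient \<open>c\<close> is the root of unity by which the two
    labellings of the branches differ.\<close>
  define c where "c = r a * r (b / a) / r b"
  have pow: "r x ^ n k = x" for x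
    unfolding r_def by (rule croot_power[OF n])
  have "r b \<noteq> 0" using pow[of b] nz n[of k] by (auto simp: power_0_left)
  have c: "c ^ n k = 1"
    using nz by (simp add: c_def power_divide power_mult_distrib pow)
  have eq: "extend k \<eta> \<sigma> \<omega> s v = extend k \<eta> \<tau> (\<omega> * c) s v" if v: "v \<in> \<tau>" for v \<omega>
  proof (cases "v \<in> far k \<eta> \<tau> s")
    case True
    then have v\<sigma>: "v \<in> far k \<eta> \<sigma> s" using far_mono[OF \<tau>] by blast
    have "f k (s v) / a = (f k (s v) / b) * (b / a)" using nz by simp
    also have "r \<dots> = r (f k (s v) / b) * r (b / a)"
      unfolding r_def by (rule croot_mult) (simp_all add: a_def b_def pos v\<sigma> ra rb')
    finally have "\<omega> * r a * r (f k (s v) / a) = \<omega> * c * r b * r (f k (s v) / b)"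
      using \<open>r b \<noteq> 0\<close> by (simp add: c_def)
    then show ?thesis
      using True v\<sigma> unfolding extend_def branch_def Let_def a_def b_def r_def by presburger
  next
    case False
    then have "v \<notin> far k \<eta> \<sigma> s" using v by (auto simp: far_def)
    with False show ?thesis by (simp add: extend_def branch_def)
  qed
  have "(\<Sum>\<omega>\<in>roots_unity k. g (extend k \<eta> \<sigma> \<omega> s)) = (\<Sum>\<omega>\<in>roots_unity k. g (extend k \<eta> \<tau> (\<omega> * c) s))"
    by (intro sum.cong refl local eq)
  also have "\<dots> = (\<Sum>\<omega>\<in>roots_unity k. g (extend k \<eta> \<tau> \<omega> s))"
  proof (rule sum.reindex_bij_witness[where i="\<lambda>\<omega>. \<omega> / c" and j="\<lambda>\<omega>. \<omega> * c"])
    have "c \<noteq> 0" using c n[of k] by (auto simp: power_0_left)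
    then show "\<omega> * c / c = \<omega>" "\<omega> / c * c = \<omega>" for \<omega> by simp_all
  qed (use c in \<open>simp_all add: roots_unity_def power_mult_distrib power_divide\<close>)
  finally show ?thesis .
qed

text \<open>If both vertices are far, the branches are a factor of norm at most 1 times roots of
  quotients near 1. Otherwise one value is below \<open>\<eta>\<close>, so both are below
  \<open>2 * \<eta>\<close>, and any choice of roots is within \<open>\<rho>\<close>.\<close>

lemma branches_near:
  assumes "\<rho> > 0"
  obtains \<eta> \<delta> where "\<eta> > 0" "\<delta> > 0" "\<delta> \<le> 1"
    "\<forall>\<sigma> s. (\<forall>v\<in>\<sigma>. \<forall>v'\<in>\<sigma>. norm (f k (s v) - f k (s v')) < \<delta> * \<eta>) \<longrightarrow>
       (\<forall>\<omega>\<in>roots_unity k. \<forall>v\<in>\<sigma>. \<forall>v'\<in>\<sigma>. norm (branch k \<eta> \<sigma> \<omega> s v - branch k \<eta> \<sigma> \<omega> s v') < \<rho>)"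
proof -
  obtain \<delta> where \<delta>: "\<delta> > 0" "\<delta> < 1" "\<And>q. norm (q - 1) < \<delta> \<Longrightarrow> norm (croot (n k) q - 1) < \<rho> / 2"
    using croot_near_1[of "\<rho>/2" "n k"] assms by auto
  \<comment> \<open>Chosen so that \<open>2 * \<eta>\<close> is the \<open>n k\<close>-th power of
    \<open>\<rho> / 2\<close>: values below it have all their roots below
    \<open>\<rho> / 2\<close>.\<close>
  define \<eta> where "\<eta> = (\<rho> / 2) ^ n k / 2"
  have \<eta>: "\<eta> > 0" using assms by (simp add: \<eta>_def)
  have norm_root_le: "norm t \<le> 1" if "t ^ n k = x" "norm x \<le> 1" for t x :: complex
  proof (rule ccontr)
    assume "\<not> norm t \<le> 1"
    then have "1 < norm t ^ n k" using n[of k] by (intro one_less_power) auto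
    moreover have "norm t ^ n k = norm x" using norm_power[of t "n k"] that(1) by simp
    ultimately show False using that(2) by linarith
  qed
  have root_small: "norm t < \<rho> / 2" if "t ^ n k = x" "norm x < 2 * \<eta>" for t x :: complex
  proof (rule ccontr)
    assume "\<not> norm t < \<rho> / 2"
    then have "(\<rho> / 2) ^ n k \<le> norm t ^ n k" using assms by (intro power_mono) auto
    moreover have "norm t ^ n k = norm x" using norm_power[of t "n k"] that(1) by simp
    ultimately show False using that(2) by (simp add: \<eta>_def)
  qed
  have "norm (branch k \<eta> \<sigma> \<omega> s v - branch k \<eta> \<sigma> \<omega> s v') < \<rho>"
    if near: "\<And>v v'. v \<in> \<sigma> \<Longrightarrow> v' \<in> \<sigma> \<Longrightarrow> norm (f k (s v) - f k (s v')) < \<delta> * \<eta>"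
      and \<omega>: "\<omega> \<in> roots_unity k" and v: "v \<in> \<sigma>" "v' \<in> \<sigma>" for \<sigma> s \<omega> v v'
  proof (cases "v \<in> far k \<eta> \<sigma> s \<and> v' \<in> far k \<eta> \<sigma> s")
    case True
    define v0 where "v0 = (SOME v. v \<in> far k \<eta> \<sigma> s)"
    have v0: "v0 \<in> far k \<eta> \<sigma> s" using True some_far unfolding v0_def by blast
    let ?a = "f k (s v0)" and ?r = "croot (n k)"
    have "norm (?r (f k (s w) / ?a) - 1) < \<rho> / 2" if "w \<in> far k \<eta> \<sigma> s" for w
      by (intro \<delta>(3) ratio_near_1[OF that v0 \<eta> near])
    from this[of v] this[of v'] have 1: "norm (?r (f k (s v) / ?a) - ?r (f k (s v') / ?a)) < \<rho>"
      using True norm_triangle_ineq4[of "?r (f k (s v) / ?a) - 1" "?r (f k (s v') / ?a) - 1"] by simp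
    have 2: "norm (\<omega> * ?r ?a) \<le> 1"
      by (rule norm_root_le[OF _ f_le[of k "s v0"]])
        (use \<omega> in \<open>simp add: power_mult_distrib roots_unity_def croot_power[OF n]\<close>)
    have "branch k \<eta> \<sigma> \<omega> s v - branch k \<eta> \<sigma> \<omega> s v' =
      (\<omega> * ?r ?a) * (?r (f k (s v) / ?a) - ?r (f k (s v') / ?a))"
      using True by (simp add: branch_def Let_def v0_def algebra_simps)
    then have "norm (branch k \<eta> \<sigma> \<omega> s v - branch k \<eta> \<sigma> \<omega> s v') \<le>
      1 * norm (?r (f k (s v) / ?a) - ?r (f k (s v') / ?a))"
      using mult_right_mono[OF 2 norm_ge_zero] by (simp only: norm_mult)
    with 1 show ?thesis by simp
  next
    case False
    have "\<delta> * \<eta> < 1 * \<eta>" using \<delta>(2) \<eta> by (intro mult_strict_right_mono)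
    moreover have "norm (f k (s v) - f k (s v')) < \<delta> * \<eta>" "norm (f k (s v) - f k (s v')) = norm (f k (s v') - f k (s v))"
      using near v by (auto simp: norm_minus_commute)
    moreover have "norm (f k (s v)) < \<eta> \<or> norm (f k (s v')) < \<eta>"
      using False v by (auto simp: far_def)
    ultimately have "norm (f k (s v)) < 2 * \<eta>" "norm (f k (s v')) < 2 * \<eta>"
      using norm_triangle_ineq2[of "f k (s v)" "f k (s v')"] norm_triangle_ineq2[of "f k (s v')" "f k (s v)"] \<eta>
      by linarith+
    from root_small[OF branch_power[OF \<omega> \<eta>, of \<sigma> s v] this(1)] root_small[OF branch_power[OF \<omega> \<eta>, of \<sigma> s v'] this(2)]
    have "norm (branch k \<eta> \<sigma> \<omega> s v) < \<rho> / 2" "norm (branch k \<eta> \<sigma> \<omega> s v') < \<rho> / 2" .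
    then show ?thesis
      using norm_triangle_ineq4[of "branch k \<eta> \<sigma> \<omega> s v" "branch k \<eta> \<sigma> \<omega> s v'"] by simp
  qed
  then show thesis using that[of \<eta> \<delta>] \<eta> \<delta> by simp
qed

lemma lifts_extend:
  assumes s: "lifts k M \<rho>' \<sigma> s" and k: "k \<ge> m" and \<omega>: "\<omega> \<in> roots_unity k" and \<eta>: "\<eta> > 0" and "\<rho>' \<le> \<rho>"
    and near: "\<And>v v'. v \<in> \<sigma> \<Longrightarrow> v' \<in> \<sigma> \<Longrightarrow> norm (branch k \<eta> \<sigma> \<omega> s v - branch k \<eta> \<sigma> \<omega> s v') < \<rho>"
  shows "lifts (Suc k) M \<rho> \<sigma> (extend k \<eta> \<sigma> \<omega> s)"
proof -
  have "extend k \<eta> \<sigma> \<omega> s v \<in> stage (Suc k)" if "v \<in> \<sigma>" for v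
    unfolding extend_def using s k that by (intro stage_Suc branch_power \<omega> \<eta>) (auto simp: lifts_def)
  moreover have "real M * extend k \<eta> \<sigma> \<omega> s v (2 * i) = real (v i)" if "v \<in> \<sigma>" "i < m" for v i
    using s k that by (simp add: extend_def lifts_def)
  moreover have "\<bar>extend k \<eta> \<sigma> \<omega> s v i - extend k \<eta> \<sigma> \<omega> s v' i\<bar> < \<rho>"
    if "v \<in> \<sigma>" "v' \<in> \<sigma>" and i: "i < 2 * Suc k" for v v' i
  proof -
    have "i < 2 * k \<or> i = 2 * k \<or> i = 2 * k + 1" using i by arith
    then consider "i < 2 * k" | "i = 2 * k" | "i = 2 * k + 1" by blast
    then show ?thesis
    proof cases
      case 1
      then have "\<bar>s v i - s v' i\<bar> < \<rho>'" using s that by (auto simp: lifts_def)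
      with 1 assms(5) show ?thesis by (simp add: extend_def)
    next
      case 2
      then show ?thesis
        using near[OF that(1,2)] abs_Re_le_cmod[of "branch k \<eta> \<sigma> \<omega> s v - branch k \<eta> \<sigma> \<omega> s v'"]
        by (simp add: extend_def set_coord_def)
    next
      case 3
      then show ?thesis
        using near[OF that(1,2)] abs_Im_le_cmod[of "branch k \<eta> \<sigma> \<omega> s v - branch k \<eta> \<sigma> \<omega> s v'"]
        by (simp add: extend_def set_coord_def)
    qed
  qed
  ultimately show ?thesis by (simp add: lifts_def)
qed

text \<open>Over the cube itself no averaging takes place: \<open>E\<close> evaluates at the single
  lift that sends a vertex \<open>v\<close> to the grid point \<open>v / M\<close>, padded with
  zeros. The mesh is made smaller than \<open>\<rho>\<close>.\<close>

lemma lift_average_base: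
  assumes "\<rho> > 0"
  shows "\<exists>M\<ge>1. \<exists>E. lift_average m M (lifts m M \<rho>) E"
proof -
  obtain M where M: "1 / real (Suc M) < \<rho>"
    using assms by (meson nat_approx_posE)
  let ?M = "Suc M"
  define s where "s v i = (if even i \<and> i < 2 * m then real (v (i div 2)) / real ?M else 0)" for v :: "nat \<Rightarrow> nat" and i
  have s: "lifts m ?M \<rho> \<sigma> s" if \<sigma>: "small m ?M \<sigma>" for \<sigma>
  proof -
    have "s v \<in> stage m" if "v \<in> \<sigma>" for v
    proof -
      have "real (v i) \<le> 1 + real M" if "i < m" for i
        using \<sigma> that \<open>v \<in> \<sigma>\<close> by (fastforce simp: small_def)
      then show ?thesis by (auto simp: stage_def unit_box_def s_def)
    qed
    moreover have "\<bar>s v i - s v' i\<bar> < \<rho>" if "v \<in> \<sigma>" "v' \<in> \<sigma>" for v v' i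
    proof (cases "even i \<and> i < 2 * m")
      case True
      then have "i div 2 < m" by auto
      then have "v (i div 2) \<le> Suc (v' (i div 2))" "v' (i div 2) \<le> Suc (v (i div 2))"
        using \<sigma> that by (auto simp: small_def)
      then have "\<bar>real (v (i div 2)) - real (v' (i div 2))\<bar> \<le> 1" by linarith
      then have "\<bar>s v i - s v' i\<bar> \<le> 1 / real ?M"
        using True by (simp add: s_def diff_divide_distrib[symmetric] divide_right_mono)
      with M show ?thesis by linarith
    qed (use assms in \<open>auto simp: s_def\<close>)
    moreover have "real ?M * s v (2 * i) = real (v i)" if "i < m" for v i
      using that by (simp add: s_def)
    ultimately show ?thesis unfolding lifts_def by blast
  qed
  have "lift_average m ?M (lifts m ?M \<rho>) (\<lambda>\<sigma> g. g s)"
  proof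
    show "g s = g' s"
      if "small m ?M \<sigma>" "\<And>s. lifts m ?M \<rho> \<sigma> s \<Longrightarrow> g s = g' s" for \<sigma> g g'
      by (rule that(2)[OF s[OF that(1)]])
  qed (rule refl)+
  then show ?thesis by (metis le_add1 plus_1_eq_Suc)
qed

text \<open>The tolerance \<open>\<rho>\<close> determines \<open>\<eta>\<close> and
  \<open>\<delta>\<close>, and uniform continuity of \<open>f k\<close> turns
  \<open>\<delta> * \<eta>\<close> into the tolerance required one level below. The new average is
  the old one applied to the mean over the branches.\<close>

lemma lift_average_step:
  assumes k: "k \<ge> m" and IH: "\<And>\<rho>. \<rho> > 0 \<Longrightarrow> \<exists>M\<ge>1. \<exists>E. lift_average m M (lifts k M \<rho>) E" and \<rho>: "\<rho> > 0"
  shows "\<exists>M\<ge>1. \<exists>E. lift_average m M (lifts (Suc k) M \<rho>) E"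
proof -
  obtain \<eta> \<delta> where \<eta>: "\<eta> > 0" and \<delta>: "\<delta> > 0" "\<delta> \<le> 1" and near:
    "\<forall>\<sigma> s. (\<forall>v\<in>\<sigma>. \<forall>v'\<in>\<sigma>. norm (f k (s v) - f k (s v')) < \<delta> * \<eta>) \<longrightarrow>
       (\<forall>\<omega>\<in>roots_unity k. \<forall>v\<in>\<sigma>. \<forall>v'\<in>\<sigma>. norm (branch k \<eta> \<sigma> \<omega> s v - branch k \<eta> \<sigma> \<omega> s v') < \<rho>)"
    by (rule branches_near[OF \<rho>])
  obtain \<rho>' where \<rho>': "\<rho>' > 0" "\<forall>w\<in>unit_box. \<forall>w'\<in>unit_box.
      (\<forall>i<2 * k. \<bar>w i - w' i\<bar> < \<rho>') \<longrightarrow> norm (f k w - f k w') < \<delta> * \<eta>"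
    by (rule f_uniform[of "\<delta> * \<eta>"]) (use \<delta> \<eta> in auto)
  obtain M E where M: "M \<ge> 1" and E: "lift_average m M (lifts k M (min \<rho> \<rho>')) E"
    using IH[of "min \<rho> \<rho>'"] \<rho> \<rho>'(1) by auto
  interpret lift_average m M "lifts k M (min \<rho> \<rho>')" E by (rule E)
  have values_near: "norm (f k (s v) - f k (s v')) < \<delta> * \<eta>"
    if "lifts k M (min \<rho> \<rho>') \<sigma> s" "v \<in> \<sigma>" "v' \<in> \<sigma>" for \<sigma> s v v'
    using that by (intro \<rho>'(2)[rule_format]) (auto simp: lifts_def stage_def)
  \<comment> \<open>The transfer of \<open>g\<close> to the level below: the mean over the
    \<open>n k\<close> branches, where coinciding branches are counted repeatedly.\<close>
  define G where "G \<sigma> g s = 1 / real (n k) * (\<Sum>\<omega>\<in>roots_unity k. g (extend k \<eta> \<sigma> \<omega> s))"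
    for \<sigma> and g :: "((nat \<Rightarrow> nat) \<Rightarrow> nat \<Rightarrow> real) \<Rightarrow> real" and s
  have "lift_average m M (lifts (Suc k) M \<rho>) (\<lambda>\<sigma> g. E \<sigma> (G \<sigma> g))"
  proof
    fix \<sigma> assume \<sigma>: "small m M \<sigma>"
    show "E \<sigma> (G \<sigma> g) = E \<sigma> (G \<sigma> g')" if "\<And>s. lifts (Suc k) M \<rho> \<sigma> s \<Longrightarrow> g s = g' s" for g g'
    proof (rule cong[OF \<sigma>])
      fix s assume s: "lifts k M (min \<rho> \<rho>') \<sigma> s"
      have "lifts (Suc k) M \<rho> \<sigma> (extend k \<eta> \<sigma> \<omega> s)" if "\<omega> \<in> roots_unity k" for \<omega>
        using values_near[OF s] that by (intro lifts_extend[OF s k _ \<eta>] near[rule_format]) auto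
      then show "G \<sigma> g s = G \<sigma> g' s"
        by (simp add: G_def that)
    qed
    show "E \<sigma> (G \<sigma> g) = E \<tau> (G \<tau> g)"
      if \<tau>: "\<tau> \<subseteq> \<sigma>" and local: "\<And>s s'. (\<And>v. v \<in> \<tau> \<Longrightarrow> s v = s' v) \<Longrightarrow> g s = g s'" for \<tau> g
    proof -
      \<comment> \<open>For a fixed lift over \<open>\<sigma>\<close> the reference vertex is moved
        into \<open>\<tau>\<close>; only afterwards is the lift itself restricted.\<close>
      have "E \<sigma> (G \<sigma> g) = E \<sigma> (G \<tau> g)"
      proof (rule cong[OF \<sigma>])
        fix s assume s: "lifts k M (min \<rho> \<rho>') \<sigma> s"
        show "G \<sigma> g s = G \<tau> g s"
          unfolding G_def by (subst sum_extend_subset[OF \<tau> \<eta> \<delta>(2) values_near[OF s] local]) auto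
      qed
      also have "\<dots> = E \<tau> (G \<tau> g)"
      proof (rule restrict[OF \<sigma> \<tau>])
        fix s s' :: "(nat \<Rightarrow> nat) \<Rightarrow> nat \<Rightarrow> real"
        assume eq: "\<And>v. v \<in> \<tau> \<Longrightarrow> s v = s' v"
        have "g (extend k \<eta> \<tau> \<omega> s) = g (extend k \<eta> \<tau> \<omega> s')" for \<omega>
          by (intro local) (simp add: extend_def eq branch_local[of \<tau> s s'])
        then show "G \<tau> g s = G \<tau> g s'" by (simp add: G_def)
      qed
      finally show ?thesis .
    qed
    show "E \<sigma> (G \<sigma> (\<lambda>s. g s + g' s)) = E \<sigma> (G \<sigma> g) + E \<sigma> (G \<sigma> g')" for g g'
      unfolding add[OF \<sigma>, symmetric] by (simp add: G_def[abs_def] sum.distrib distrib_left add_divide_distrib)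
    show "E \<sigma> (G \<sigma> (\<lambda>s. c * g s)) = c * E \<sigma> (G \<sigma> g)" for c g
      unfolding scale[OF \<sigma>, symmetric] by (simp add: G_def[abs_def] sum_distrib_left mult_ac)
    show "E \<sigma> (G \<sigma> (\<lambda>_. 1)) = 1"
      using one[OF \<sigma>] n[of k] by (simp add: G_def[abs_def] card_roots_unity)
  qed
  with M show ?thesis by blast
qed

lemma lift_average_exists:
  assumes "k \<ge> m" "\<rho> > 0"
  shows "\<exists>M\<ge>1. \<exists>E. lift_average m M (lifts k M \<rho>) E"
  using assms
proof (induction k arbitrary: \<rho> rule: dec_induct)
  case base
  then show ?case by (rule lift_average_base)
next
  case (step k)
  then show ?case by (intro lift_average_step) auto
qed

end

subsection \<open>Lower bound for the dimension\<close>

text \<open>\<open>W S\<close> is where the functions of \<open>S\<close> dominate all others, the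
  analogue of the open star of the barycentre of \<open>S\<close> in the subdivided nerve. Distinct
  sets of equal size are not nested, which gives contradictory inequalities on the overlap. A cover
  of multiplicity \<open>k\<close> thus becomes \<open>k\<close> disjoint families, indexed by
  \<open>card S\<close>.\<close>

lemma exists_disjoint_levels:
  fixes K :: "'a::metric_space set"
  assumes K: "closed K" and fin: "finite \<V>" and op: "\<And>V. V \<in> \<V> \<Longrightarrow> openin (top_of_set K) V"
    and cov: "\<Union>\<V> = K" and mult: "\<And>x. x \<in> K \<Longrightarrow> card {V \<in> \<V>. x \<in> V} \<le> k"
  obtains W :: "'a set set \<Rightarrow> 'a set" where
    "\<And>S. S \<subseteq> \<V> \<Longrightarrow> openin (top_of_set K) (W S)"
    "\<And>S V. S \<subseteq> \<V> \<Longrightarrow> V \<in> S \<Longrightarrow> W S \<subseteq> V"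
    "\<And>S S'. S \<subseteq> \<V> \<Longrightarrow> S' \<subseteq> \<V> \<Longrightarrow> card S = card S' \<Longrightarrow> S \<noteq> S' \<Longrightarrow> W S \<inter> W S' = {}"
    "\<And>x. x \<in> K \<Longrightarrow> \<exists>S\<subseteq>\<V>. S \<noteq> {} \<and> card S \<le> k \<and> x \<in> W S"
proof -
  \<comment> \<open>\<open>infdist x {} = 0\<close>, hence the case distinction\<close>
  define \<phi> where "\<phi> V x = (if K - V = {} then 1 else infdist x (K - V))" for V x
  have cont: "continuous_on UNIV (\<phi> V)" for V
    by (cases "K - V = {}") (auto simp: \<phi>_def[abs_def] intro!: continuous_intros)
  have pos: "0 < \<phi> V x \<longleftrightarrow> x \<in> V" if V: "V \<in> \<V>" and x: "x \<in> K" for V x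
  proof (cases "K - V = {}")
    case True
    then show ?thesis using x by (auto simp: \<phi>_def)
  next
    case False
    have "closedin (top_of_set K) (K - V)"
      using op[OF V] openin_imp_subset[OF op[OF V]] by (simp add: closedin_def double_diff)
    then have "closed (K - V)" using K closedin_closed_trans by blast
    then have "infdist x (K - V) = 0 \<longleftrightarrow> x \<in> K - V"
      using False in_closed_iff_infdist_zero[of "K - V" x] by blast
    then show ?thesis
      using False x infdist_nonneg[of x "K - V"] by (auto simp: \<phi>_def less_le)
  qed
  \<comment> \<open>For empty \<open>S\<close> the condition is vacuous and \<open>W S\<close> is
    all of \<open>K\<close>; hence \<open>S \<noteq> {}\<close> in the covering clause.\<close>
  define W where "W S = {x \<in> K. \<forall>V\<in>S. 0 < \<phi> V x \<and> (\<forall>V'\<in>\<V> - S. \<phi> V' x < \<phi> V x)}" for S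
  show thesis
  proof (rule that[of W])
    fix S assume S: "S \<subseteq> \<V>"
    have "finite S" "finite (\<V> - S)" using S fin finite_subset by auto
    then have "open (\<Inter>V\<in>S. {x. 0 < \<phi> V x} \<inter> (\<Inter>V'\<in>\<V> - S. {x. \<phi> V' x < \<phi> V x}))"
      by (intro open_INT open_Int ballI open_Collect_less cont continuous_intros)
    moreover have "W S = K \<inter> (\<Inter>V\<in>S. {x. 0 < \<phi> V x} \<inter> (\<Inter>V'\<in>\<V> - S. {x. \<phi> V' x < \<phi> V x}))"
      by (auto simp: W_def)
    ultimately show "openin (top_of_set K) (W S)"
      by (simp add: openin_open_Int)
    show "W S \<subseteq> V" if "V \<in> S" for V
      using pos that S by (auto simp: W_def)
    show "W S \<inter> W S' = {}" if S': "S' \<subseteq> \<V>" "card S = card S'" "S \<noteq> S'" for S'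
    proof -
      have "finite S'" using S' fin finite_subset by auto
      then have "\<not> S \<subseteq> S'" "\<not> S' \<subseteq> S"
        using S' \<open>finite S\<close> card_subset_eq by metis+
      then obtain V V' where "V \<in> S" "V \<notin> S'" "V' \<in> S'" "V' \<notin> S" by blast
      then have "\<phi> V' x < \<phi> V x" "\<phi> V x < \<phi> V' x" if "x \<in> W S \<inter> W S'" for x
        using that S S' by (auto simp: W_def)
      then show ?thesis by (meson disjoint_iff IntI less_asym)
    qed
  next
    fix x assume x: "x \<in> K"
    then obtain V0 where V0: "V0 \<in> \<V>" "x \<in> V0" using cov by blast
    define \<mu> where "\<mu> = Max ((\<lambda>V. \<phi> V x) ` \<V>)"
    have le: "\<phi> V x \<le> \<mu>" if "V \<in> \<V>" for V
      using that fin by (simp add: \<mu>_def)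
    have "\<mu> \<in> (\<lambda>V. \<phi> V x) ` \<V>"
      unfolding \<mu>_def using fin V0 by (intro Max_in) auto
    moreover have "\<mu> > 0" using le[OF V0(1)] pos[OF V0(1) x] V0(2) by simp
    \<comment> \<open>The members of maximal value at \<open>x\<close>; as the maximum is positive,
      all of them contain \<open>x\<close>, which bounds \<open>card S\<close> by the
      multiplicity.\<close>
    moreover define S where "S = {V \<in> \<V>. \<phi> V x = \<mu>}"
    ultimately have "S \<noteq> {}" and pos_S: "\<And>V. V \<in> S \<Longrightarrow> 0 < \<phi> V x" and "S \<subseteq> \<V>"
      by (auto simp: S_def)
    moreover from this have "S \<subseteq> {V \<in> \<V>. x \<in> V}" using pos[OF _ x] by blast
    moreover have "\<phi> V' x < \<phi> V x" if "V \<in> S" "V' \<in> \<V> - S" for V V'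
      using that le[of V'] by (auto simp: S_def less_le)
    then have "x \<in> W S" using x pos_S by (simp add: W_def)
    moreover have "card S \<le> k"
      using card_mono[OF _ \<open>S \<subseteq> {V \<in> \<V>. x \<in> V}\<close>] fin mult[OF x] by simp
    ultimately show "\<exists>S\<subseteq>\<V>. S \<noteq> {} \<and> card S \<le> k \<and> x \<in> W S" by blast
  qed
qed

text \<open>The Lebesgue number is expressed through finitely many coordinates so that a finite
  level of the tower decides whether a set is small.\<close>

lemma coordinate_Lebesgue_number:
  fixes K :: "(nat \<Rightarrow> real) set"
  assumes K: "compact K" and op: "\<And>U. U \<in> \<U> \<Longrightarrow> openin (top_of_set K) U" and cov: "K \<subseteq> \<Union>\<U>"
  obtains \<rho> N where "\<rho> > 0" "\<forall>P. P \<subseteq> K \<and> P \<noteq> {} \<and>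
      (\<forall>x\<in>P. \<forall>y\<in>P. \<forall>i<N. \<bar>x i - y i\<bar> < \<rho>) \<longrightarrow> (\<exists>U\<in>\<U>. P \<subseteq> U)"
proof (cases "K = {}")
  case True
  then show thesis using that[of 1 0] by simp
next
  case False
  define \<C> where "\<C> = {T. open T \<and> (\<exists>U\<in>\<U>. K \<inter> T \<subseteq> U)}"
  have "\<exists>T\<in>\<C>. x \<in> T" if x: "x \<in> K" for x
  proof -
    obtain U where U: "U \<in> \<U>" "x \<in> U" using x cov by blast
    then obtain T where "open T" "U = K \<inter> T" using op by (auto simp: openin_open)
    then show ?thesis using U unfolding \<C>_def by blast
  qed
  then have cov': "\<C> \<noteq> {}" "K \<subseteq> \<Union>\<C>" using False by blast+
  have "\<exists>\<delta>>0. \<forall>P. P \<subseteq> K \<longrightarrow> diameter P < \<delta> \<longrightarrow> (\<exists>T\<in>\<C>. P \<subseteq> T)"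
    by (rule Lebesgue_number_lemma[OF K cov']) (auto simp: \<C>_def)
  then obtain \<delta> where \<delta>: "\<delta> > 0" "\<And>P. P \<subseteq> K \<Longrightarrow> diameter P < \<delta> \<Longrightarrow> \<exists>T\<in>\<C>. P \<subseteq> T" by blast
  obtain \<rho> N where \<rho>: "\<rho> > 0" "\<forall>w w' :: nat \<Rightarrow> real. (\<forall>i<N. \<bar>w i - w' i\<bar> < \<rho>) \<longrightarrow> dist w w' < \<delta> / 2"
    by (rule dist_fun_less[of "\<delta> / 2"]) (use \<delta>(1) in auto)
  have *: "\<exists>U\<in>\<U>. P \<subseteq> U" if P: "P \<subseteq> K" "P \<noteq> {}" "\<forall>x\<in>P. \<forall>y\<in>P. \<forall>i<N. \<bar>x i - y i\<bar> < \<rho>" for P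
  proof -
    have "dist x y \<le> \<delta> / 2" if "x \<in> P" "y \<in> P" for x y
      using P(3) \<rho>(2) that by (simp add: less_imp_le)
    then have "(SUP (x, y)\<in>P \<times> P. dist x y) \<le> \<delta> / 2"
      using P(2) by (intro cSUP_least) auto
    then have "diameter P \<le> \<delta> / 2"
      using P(2) by (simp add: diameter_def)
    then have "\<exists>T\<in>\<C>. P \<subseteq> T" using \<delta> P(1) by simp
    then show ?thesis using P(1) unfolding \<C>_def by blast
  qed
  show thesis by (rule that[OF \<rho>(1)]) (use * in blast)
qed

context root_tower
begin

lemma multiplicity_gt:
  assumes m: "m \<ge> 1" and ref: "refinable_with_multiplicity (top_of_set tower) k"
  shows "k > m"
proof (rule ccontr)
  assume "\<not> k > m"
  then have km: "k \<le> m" by simp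
  \<comment> \<open>No \<open>U A\<close> meets both faces of a pair: a point with
    \<open>w (2 * i) = 0\<close> forces \<open>i\<close> outside \<open>A\<close>, and the value 1
    forces \<open>i\<close> into \<open>A\<close>.\<close>
  define U where "U A = {w \<in> tower. \<forall>i<m. if i \<in> A then 0 < w (2 * i) else w (2 * i) < 1}" for A :: "nat set"
  have U: "openin (top_of_set tower) (U A)" for A
  proof -
    have "U A = tower \<inter> (\<Inter>i\<in>{..<m}. if i \<in> A then {w. 0 < w (2 * i)} else {w. w (2 * i) < 1})"
      by (auto simp: U_def split: if_splits)
    moreover have "open (\<Inter>i\<in>{..<m}. if i \<in> A then {w :: nat \<Rightarrow> real. 0 < w (2 * i)} else {w. w (2 * i) < 1})"
      by (intro open_INT ballI) (auto intro!: open_Collect_less continuous_on_coordinate continuous_intros)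
    ultimately show ?thesis by (simp add: openin_open_Int)
  qed
  have "open_cover (top_of_set tower) (U ` Pow {..<m})"
    unfolding open_cover_def
  proof (intro conjI equalityI subsetI)
    fix w assume "w \<in> topspace (top_of_set tower)"
    then have "w \<in> U {i. i < m \<and> 0 < w (2 * i)}" by (auto simp: U_def)
    then show "w \<in> \<Union> (U ` Pow {..<m})"
      by (rule UnionI[OF imageI, rotated]) auto
  qed (use U in \<open>auto simp: U_def\<close>)
  moreover have "finite (U ` Pow {..<m})" by simp
  ultimately have "\<exists>\<V>. finite \<V> \<and> open_cover (top_of_set tower) \<V> \<and> refines \<V> (U ` Pow {..<m}) \<and>
      (\<forall>w\<in>topspace (top_of_set tower). card {V \<in> \<V>. w \<in> V} \<le> k)"
    using ref unfolding refinable_with_multiplicity_def by blast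
  then obtain \<V> where \<V>: "finite \<V>" "open_cover (top_of_set tower) \<V>" "refines \<V> (U ` Pow {..<m})"
    "\<And>w. w \<in> tower \<Longrightarrow> card {V \<in> \<V>. w \<in> V} \<le> k"
    by auto
  obtain W where W_open: "\<And>S. S \<subseteq> \<V> \<Longrightarrow> openin (top_of_set tower) (W S)"
    and W_sub: "\<And>S V. S \<subseteq> \<V> \<Longrightarrow> V \<in> S \<Longrightarrow> W S \<subseteq> V"
    and W_disj: "\<And>S S'. S \<subseteq> \<V> \<Longrightarrow> S' \<subseteq> \<V> \<Longrightarrow> card S = card S' \<Longrightarrow> S \<noteq> S' \<Longrightarrow> W S \<inter> W S' = {}"
    and W_cover: "\<And>x. x \<in> tower \<Longrightarrow> \<exists>S\<subseteq>\<V>. S \<noteq> {} \<and> card S \<le> k \<and> x \<in> W S"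
  proof (rule exists_disjoint_levels[OF compact_imp_closed[OF compact_tower] \<V>(1), of k])
    show "openin (top_of_set tower) V" if "V \<in> \<V>" for V
      using that \<V>(2) by (simp add: open_cover_def)
    show "\<Union>\<V> = tower"
      using \<V>(2) by (simp add: open_cover_def)
  qed (use \<V>(4) in blast)+
  \<comment> \<open>The family with \<open>card S = Suc i\<close> serves the \<open>i\<close>-th
    pair of faces: \<open>u i\<close> is 1 on those of its members that meet the upper face. The
    first disjunct treats points of that face outside the family.\<close>
  define u :: "nat \<Rightarrow> (nat \<Rightarrow> real) \<Rightarrow> real" where
    "u i w = (if w (2 * i) = 1 \<or> (\<exists>S\<subseteq>\<V>. card S = Suc i \<and> w \<in> W S \<and> (\<exists>w'\<in>W S. w' (2 * i) = 1)) then 1 else 0)" for i w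
  have u_const: "u i w = u i w'" if "S \<subseteq> \<V>" "card S = Suc i" "w \<in> W S" "w' \<in> W S" for S i w w'
  proof -
    have "u i v = (if \<exists>w'\<in>W S. w' (2 * i) = 1 then 1 else 0)" if "v \<in> W S" for v
    proof -
      have "S' = S" if "S' \<subseteq> \<V>" "card S' = Suc i" "v \<in> W S'" for S'
        using W_disj[of S S'] that \<open>S \<subseteq> \<V>\<close> \<open>card S = Suc i\<close> \<open>v \<in> W S\<close> by auto
      then have "(v (2 * i) = 1 \<or> (\<exists>S'\<subseteq>\<V>. card S' = Suc i \<and> v \<in> W S' \<and> (\<exists>w'\<in>W S'. w' (2 * i) = 1)))
          \<longleftrightarrow> (\<exists>w'\<in>W S. w' (2 * i) = 1)"
        using \<open>S \<subseteq> \<V>\<close> \<open>card S = Suc i\<close> \<open>v \<in> W S\<close> by metis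
      then show ?thesis by (simp only: u_def)
    qed
    with that show ?thesis by simp
  qed
  have u0: "u i w = 0" if "i < m" "w (2 * i) = 0" for i w
  proof -
    have False if S: "S \<subseteq> \<V>" "card S = Suc i" "w \<in> W S" "w' \<in> W S" "w' (2 * i) = 1" for S w'
    proof -
      obtain V where "V \<in> S" using S(2) by fastforce
      then obtain A where "V \<subseteq> U A"
        using S(1) \<V>(3) unfolding refines_def by blast
      then have "w \<in> U A" "w' \<in> U A" using W_sub[OF S(1) \<open>V \<in> S\<close>] S by auto
      with \<open>i < m\<close> \<open>w (2 * i) = 0\<close> S(5) show False
        by (auto simp: U_def split: if_splits dest!: spec[of _ i])
    qed
    with that show ?thesis unfolding u_def by auto
  qed
  have u1: "u i w = 1" if "w (2 * i) = 1" for i w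
    using that by (simp add: u_def)
  let ?\<S> = "{S. S \<subseteq> \<V> \<and> S \<noteq> {} \<and> card S \<le> k}"
  obtain \<rho> N where \<rho>: "\<rho> > 0" "\<forall>P. P \<subseteq> tower \<and> P \<noteq> {} \<and>
      (\<forall>x\<in>P. \<forall>y\<in>P. \<forall>i<N. \<bar>x i - y i\<bar> < \<rho>) \<longrightarrow> (\<exists>B\<in>W ` ?\<S>. P \<subseteq> B)"
  proof (rule coordinate_Lebesgue_number[OF compact_tower, of "W ` ?\<S>"])
    show "tower \<subseteq> \<Union> (W ` ?\<S>)"
    proof
      fix x assume "x \<in> tower"
      then obtain S where "S \<in> ?\<S>" "x \<in> W S" using W_cover by blast
      then show "x \<in> \<Union> (W ` ?\<S>)" by blast
    qed
  qed (use W_open in blast)+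
  define l where "l = max m N"
  have l: "l \<ge> m" "l \<ge> 1" "N \<le> 2 * l" using m by (auto simp: l_def)
  \<comment> \<open>Any extension to the tower will do, continuous or not: the Lebesgue property
    looks only at coordinates below \<open>N\<close>, which \<open>e\<close> preserves.\<close>
  have "\<forall>w. \<exists>w'. w \<in> stage l \<longrightarrow> w' \<in> tower \<and> (\<forall>i<2 * l. w' i = w i)"
    using stage_extend[OF _ l(1,2)] by metis
  then obtain e where e: "\<And>w. w \<in> stage l \<Longrightarrow> e w \<in> tower" "\<And>w i. w \<in> stage l \<Longrightarrow> i < 2 * l \<Longrightarrow> e w i = w i"
    by metis
  obtain M E where M: "M \<ge> 1" and "lift_average m M (lifts l M \<rho>) E"
    using lift_average_exists[OF l(1) \<rho>(1)] by blast
  then interpret lift_average m M "lifts l M \<rho>" E by simp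
  obtain \<sigma> s where s: "lifts l M \<rho> \<sigma> s"
    and complete: "\<And>i. i < m \<Longrightarrow> \<exists>v\<in>\<sigma>. \<exists>v'\<in>\<sigma>. u i (e (s v)) \<noteq> u i (e (s v'))"
  proof (rule exists_complete_lift[of "\<lambda>i w. u i (e w)"])
    fix \<sigma> s v i assume *: "lifts l M \<rho> \<sigma> s" "v \<in> \<sigma>" "i < m"
    then have eq: "real M * e (s v) (2 * i) = real (v i)"
      using e(2)[of "s v" "2 * i"] l by (auto simp: lifts_def)
    show "u i (e (s v)) = 0" if "v i = 0"
      using eq that M u0[OF *(3)] by simp
    show "u i (e (s v)) = 1" if "v i = M"
      using eq that M u1[of "e (s v)" i] by simp
  qed (use M in auto)
  define P where "P = (\<lambda>v. e (s v)) ` \<sigma>"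
  have "P \<noteq> {}" using complete[of 0] m by (auto simp: P_def)
  moreover have "P \<subseteq> tower" using s e(1) by (auto simp: P_def lifts_def)
  moreover have "\<bar>x i - y i\<bar> < \<rho>" if xy: "x \<in> P" "y \<in> P" and i: "i < N" for x y i
  proof -
    obtain v v' where v: "v \<in> \<sigma>" "v' \<in> \<sigma>" "x = e (s v)" "y = e (s v')"
      using xy by (auto simp: P_def)
    then show ?thesis
      using s e(2)[of "s v" i] e(2)[of "s v'" i] i l(3) by (auto simp: lifts_def)
  qed
  ultimately obtain S where "S \<in> ?\<S>" and S: "P \<subseteq> W S"
    using \<rho>(2)[rule_format, of P] by blast
  then have S: "S \<subseteq> \<V>" "S \<noteq> {}" "card S \<le> k" "P \<subseteq> W S" by simp_all
  \<comment> \<open>All of \<open>P\<close> lies in one \<open>W S\<close>, so this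
    \<open>u i\<close> is constant on the lift; \<open>i < m\<close> because
    \<open>card S \<le> k \<le> m\<close>.\<close>
  define i where "i = card S - 1"
  have "finite S" using S(1) \<V>(1) finite_subset by blast
  then have "card S = Suc i" "i < m"
    using S(2,3) km card_gt_0_iff[of S] by (auto simp: i_def)
  then have "u i (e (s v)) = u i (e (s v'))" if "v \<in> \<sigma>" "v' \<in> \<sigma>" for v v'
    using u_const[OF S(1), of i "e (s v)" "e (s v')"] S(4) that by (auto simp: P_def)
  with complete[OF \<open>i < m\<close>] show False by blast
qed

end

subsection \<open>Upper bound for the dimension\<close>

text \<open>Let \<open>j\<close> be least such that at most \<open>j\<close> of the values are
  \<open>\<le> c j\<close>. For \<open>j > 0\<close> minimality gives at least \<open>j\<close>
  values \<open>\<le> c (j - 1)\<close>, so both counts equal \<open>j\<close> and no value lies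
  between the two thresholds. This gap makes both inequalities strict.\<close>

lemma exists_threshold:
  fixes t c :: "nat \<Rightarrow> real"
  assumes c: "strict_mono c"
  obtains S where "S \<subseteq> {..<m}" "\<forall>i\<in>S. t i < c (card S)" "\<forall>i\<in>{..<m} - S. c (card S) < t i"
proof -
  define N where "N j = {i. i < m \<and> t i \<le> c j}" for j
  have fin: "finite (N j)" for j by (simp add: N_def)
  define j where "j = (LEAST j. card (N j) \<le> j)"
  have "card (N m) \<le> m"
    using card_mono[of "{..<m}" "N m"] by (auto simp: N_def)
  then have j: "card (N j) \<le> j" unfolding j_def by (rule LeastI)
  show thesis
  proof (cases j)
    case 0
    then have "N 0 = {}" using j fin[of 0] by simp
    then show thesis using that[of "{}"] by (auto simp: N_def not_le)
  next
    case (Suc l)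
    then have "\<not> card (N l) \<le> l"
      using not_less_Least[of l "\<lambda>j. card (N j) \<le> j"] by (simp add: j_def)
    then have l: "card (N l) \<ge> j" using Suc by simp
    have c': "c l < c j" using Suc c by (simp add: strict_mono_def)
    then have "N l \<subseteq> N j" by (auto simp: N_def)
    then have eq: "N l = N j" and card: "card (N j) = j"
      using card_seteq[OF fin[of j], of "N l"] card_mono[OF fin[of j], of "N l"] j l by auto
    show thesis
    proof (rule that[of "N j"])
      have "t i \<le> c l" if "i \<in> N j" for i using that eq by (auto simp: N_def)
      then show "\<forall>i\<in>N j. t i < c (card (N j))" using c' unfolding card by force
      show "\<forall>i\<in>{..<m} - N j. c (card (N j)) < t i" unfolding card by (auto simp: N_def)
    qed (auto simp: N_def)
  qed
qed

text \<open>Any increasing sequence with values strictly between 0 and 1/2 for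
  \<open>j \<le> m\<close> would serve; here \<open>j + 1 < m + 2\<close>.\<close>

definition brick_threshold :: "nat \<Rightarrow> nat \<Rightarrow> real" where
  "brick_threshold m j = real (j + 1) / real (2 * (m + 2))"

text \<open>For fixed \<open>card S = j\<close> the bricks are disjoint and thicken the cells of codimension \<open>j\<close> of the integer
  grid; all bricks together cover because the thresholds increase with \<open>j\<close>.\<close>

definition brick :: "nat \<Rightarrow> nat set \<Rightarrow> (nat \<Rightarrow> int) \<Rightarrow> (nat \<Rightarrow> real) set" where
  "brick m S a = {x. (\<forall>i\<in>S. \<bar>x i - of_int (a i)\<bar> < brick_threshold m (card S)) \<and>
     (\<forall>i\<in>{..<m} - S. of_int (a i) + brick_threshold m (card S) < x i \<and>
        x i < of_int (a i) + 1 - brick_threshold m (card S))}"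

lemma brick_threshold_bounds:
  assumes "S \<subseteq> {..<m}"
  shows "0 < brick_threshold m (card S)" "brick_threshold m (card S) < 1/2"
proof -
  have "card S \<le> m" using card_mono[OF _ assms] by simp
  then show "0 < brick_threshold m (card S)" "brick_threshold m (card S) < 1/2"
    by (simp_all add: brick_threshold_def field_simps)
qed

lemma brick_diff:
  assumes "x \<in> brick m S a" "y \<in> brick m S a" "S \<subseteq> {..<m}" "i < m"
  shows "\<bar>x i - y i\<bar> < 1"
proof (cases "i \<in> S")
  case True
  then have "\<bar>x i - of_int (a i)\<bar> < brick_threshold m (card S)" "\<bar>y i - of_int (a i)\<bar> < brick_threshold m (card S)"
    using assms(1,2) by (simp_all add: brick_def)
  then show ?thesis using brick_threshold_bounds[OF assms(3)] by linarith
next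
  case False
  then have "of_int (a i) + brick_threshold m (card S) < z i \<and> z i < of_int (a i) + 1 - brick_threshold m (card S)"
    if "z \<in> brick m S a" for z
    using that assms(4) by (simp add: brick_def)
  from this[OF assms(1)] this[OF assms(2)] show ?thesis
    using brick_threshold_bounds[OF assms(3)] by linarith
qed

lemma brick_disjoint:
  assumes x: "x \<in> brick m S a" "x \<in> brick m S' a'" and S: "S \<subseteq> {..<m}" "S' \<subseteq> {..<m}"
    and card: "card S = card S'"
  shows "S = S' \<and> (\<forall>i<m. a i = a' i)"
proof -
  define c where "c = brick_threshold m (card S)"
  have c: "0 < c" "c < 1/2" unfolding c_def by (rule brick_threshold_bounds[OF S(1)])+
  have near: "\<bar>x i - of_int (a i)\<bar> < c" if "i \<in> S" for i
    using x(1) that by (simp add: brick_def c_def)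
  have near': "\<bar>x i - of_int (a' i)\<bar> < c" if "i \<in> S'" for i
    using x(2) that card by (simp add: brick_def c_def)
  have away: "of_int (a i) + c < x i \<and> x i < of_int (a i) + 1 - c" if "i < m" "i \<notin> S" for i
    using x(1) that by (simp add: brick_def c_def)
  have away': "of_int (a' i) + c < x i \<and> x i < of_int (a' i) + 1 - c" if "i < m" "i \<notin> S'" for i
    using x(2) that card by (simp add: brick_def c_def)
  \<comment> \<open>A point within \<open>c\<close> of an integer is not further than
    \<open>c\<close> from both ends of a unit interval that contains it; this recovers
    \<open>S\<close> from \<open>x\<close>.\<close>
  have no: False if "\<bar>z - of_int p\<bar> < c" "of_int q + c < z \<and> z < of_int q + 1 - c" for z and p q :: int
  proof -
    have "of_int q < (of_int p :: real)" "of_int p < (of_int (q + 1) :: real)"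
      using that unfolding of_int_add by linarith+
    then show False by (simp only: of_int_less_iff)
  qed
  have "S = S'"
    using no near near' away away' S by blast
  moreover have "a i = a' i" if "i < m" for i
  proof (cases "i \<in> S")
    case True
    then have "real_of_int (a i) < of_int (a' i + 1)" "real_of_int (a' i) < of_int (a i + 1)"
      using near[of i] near'[of i] \<open>S = S'\<close> c unfolding of_int_add by (auto simp: abs_less_iff)
    then show ?thesis by (simp only: of_int_less_iff)
  next
    case False
    then have "real_of_int (a i) < of_int (a' i + 1)" "real_of_int (a' i) < of_int (a i + 1)"
      using away[OF that] away'[OF that] \<open>S = S'\<close> c by auto
    then show ?thesis by (simp only: of_int_less_iff)
  qed
  ultimately show ?thesis by simp
qed

lemma brick_cover:
  fixes x :: "nat \<Rightarrow> real"
  assumes "\<And>i. i < m \<Longrightarrow> 0 \<le> x i" "\<And>i. i < m \<Longrightarrow> x i \<le> real M"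
  obtains S a where "S \<subseteq> {..<m}" "a \<in> PiE {..<m} (\<lambda>_. {0..int M + 1})" "x \<in> brick m S a"
proof -
  define t where "t i = min (frac (x i)) (1 - frac (x i))" for i
  have "strict_mono (brick_threshold m)"
    by (auto simp: strict_mono_def brick_threshold_def divide_strict_right_mono)
  then obtain S where S: "S \<subseteq> {..<m}" "\<forall>i\<in>S. t i < brick_threshold m (card S)"
    "\<forall>i\<in>{..<m} - S. brick_threshold m (card S) < t i"
    by (rule exists_threshold[of _ m t])
  \<comment> \<open>Nearest integer for \<open>i\<close> in \<open>S\<close>, floor otherwise;
    \<open>undefined\<close> beyond \<open>m\<close> makes \<open>a\<close> extensional, as
    \<open>PiE\<close> demands.\<close>
  define a where "a i = (if i < m then if i \<in> S \<and> frac (x i) > 1/2 then \<lfloor>x i\<rfloor> + 1 else \<lfloor>x i\<rfloor> else undefined)" for i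
  have x: "x i = of_int \<lfloor>x i\<rfloor> + frac (x i)" for i by (simp add: frac_def)
  have f: "0 \<le> frac (x i)" "frac (x i) < 1" for i by (auto simp: frac_lt_1)
  show thesis
  proof (rule that[of S a])
    show "a \<in> PiE {..<m} (\<lambda>_. {0..int M + 1})"
    proof
      fix i assume "i \<in> {..<m}"
      then have "0 \<le> \<lfloor>x i\<rfloor>" "\<lfloor>x i\<rfloor> \<le> int M"
        using assms[of i] by (auto simp: floor_le_iff)
      then show "a i \<in> {0..int M + 1}" using \<open>i \<in> {..<m}\<close> by (auto simp: a_def)
    qed (simp add: a_def)
    have "\<bar>x i - of_int (a i)\<bar> < brick_threshold m (card S)" if "i \<in> S" for i
    proof -
      have "i < m" using that S(1) by auto
      then have "\<bar>x i - of_int (a i)\<bar> = t i"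
        using that x[of i] f[of i] by (auto simp: a_def t_def min_def)
      then show ?thesis using S(2) that by simp
    qed
    moreover have "of_int (a i) + brick_threshold m (card S) < x i \<and> x i < of_int (a i) + 1 - brick_threshold m (card S)"
      if "i \<in> {..<m} - S" for i
      using S(3)[rule_format, OF that] that x[of i] by (auto simp: a_def t_def)
    ultimately show "x \<in> brick m S a" by (simp add: brick_def)
  qed (rule S(1))
qed

lemma card_le_1_if_disjoint:
  assumes "\<And>V V'. V \<in> \<V> \<Longrightarrow> V' \<in> \<V> \<Longrightarrow> x \<in> V \<Longrightarrow> x \<in> V' \<Longrightarrow> V = V'"
  shows "card {V \<in> \<V>. x \<in> V} \<le> 1"
proof -
  have "card {V \<in> \<V>. x \<in> V} \<le> card {x}" if "V0 \<in> \<V>" "x \<in> V0" for V0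
  proof -
    have "{V \<in> \<V>. x \<in> V} = {V0}" using assms that by blast
    then show ?thesis by simp
  qed
  moreover have "card {V \<in> \<V>. x \<in> V} = 0" if "{V \<in> \<V>. x \<in> V} = {}"
    by (simp only: that card.empty)
  ultimately show ?thesis by fastforce
qed

section \<open>Finite fibres over the cube and the lifted brick cover\<close>

context root_tower
begin

text \<open>The l1-distance of the projections to the cube; on the tower it vanishes exactly on
  pairs in one fibre.\<close>

definition base_dist :: "(nat \<Rightarrow> real) \<Rightarrow> (nat \<Rightarrow> real) \<Rightarrow> real" where
  "base_dist w w' = (\<Sum>i<m. \<bar>w (2 * i) - w' (2 * i)\<bar>)"

definition truncate :: "nat \<Rightarrow> (nat \<Rightarrow> real) \<Rightarrow> nat \<Rightarrow> real" where
  "truncate k w = (\<lambda>i. if i < 2 * k then w i else 0)"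

lemma truncate_Suc: "truncate (Suc k) w = set_coord k (coord k w) (truncate k w)"
proof
  fix i
  have "i < 2 * Suc k \<longleftrightarrow> i < 2 * k \<or> i = 2 * k \<or> i = 2 * k + 1" by arith
  then show "truncate (Suc k) w i = set_coord k (coord k w) (truncate k w) i"
    by (simp add: truncate_def set_coord_def coord_def)
qed

text \<open>Profiniteness of the fibres in finite terms: a coordinate below \<open>m\<close> is
  prescribed by the base point, and every later one has finitely many possible roots.\<close>

lemma finite_truncate_fibre:
  "finite (truncate k ` {w' \<in> tower. \<forall>i<m. w' (2 * i) = w (2 * i)})"
proof (induction k)
  case 0
  have "truncate 0 ` {w' \<in> tower. \<forall>i<m. w' (2 * i) = w (2 * i)} \<subseteq> {\<lambda>_. 0}"
    by (auto simp: truncate_def)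
  then show ?case using finite_subset by blast
next
  case (Suc k)
  let ?F = "{w' \<in> tower. \<forall>i<m. w' (2 * i) = w (2 * i)}"
  define R where "R c = (if k < m then {Complex (w (2 * k)) 0} else {t. t ^ n k = f k c})" for c
  have fin: "finite (R c)" for c
    using n[of k] by (auto simp: R_def)
  have "coord k w' \<in> R (truncate k w')" if "w' \<in> ?F" for w'
  proof -
    have stage: "w' \<in> stage (Suc k)" using that by (auto simp: tower_def)
    have "f k (truncate k w') = f k w'" by (intro f_dep) (simp add: truncate_def)
    then show ?thesis
      using stage that by (auto simp: R_def stage_def coord_def)
  qed
  then have "truncate (Suc k) ` ?F \<subseteq> (\<Union>c\<in>truncate k ` ?F. (\<lambda>t. set_coord k t c) ` R c)"
    by (auto simp: truncate_Suc)
  moreover have "finite (\<Union>c\<in>truncate k ` ?F. (\<lambda>t. set_coord k t c) ` R c)"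
    by (intro finite_UN_I finite_imageI Suc fin)
  ultimately show ?case using finite_subset by blast
qed

definition disjoint_small :: "nat \<Rightarrow> real \<Rightarrow> (nat \<Rightarrow> real) set set \<Rightarrow> bool" where
  "disjoint_small N \<rho> \<W> \<longleftrightarrow> finite \<W> \<and> (\<forall>V\<in>\<W>. open V) \<and>
     (\<forall>V\<in>\<W>. \<forall>V'\<in>\<W>. V \<noteq> V' \<longrightarrow> V \<inter> V' = {}) \<and>
     (\<forall>V\<in>\<W>. \<forall>x\<in>V. \<forall>y\<in>V. \<forall>i<N. \<bar>x i - y i\<bar> < \<rho>)"

text \<open>A tube argument: small disjoint balls around the finitely many truncated fibre points
  contain the whole fibre, and by compactness the rest of the tower projects to positive distance
  from the base point.\<close>

lemma fibre_neighbourhood: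
  assumes \<rho>: "\<rho> > 0"
  obtains \<delta> \<W> where "\<delta> > 0" "disjoint_small N \<rho> \<W>"
    "\<forall>w'\<in>tower. base_dist w' w < \<delta> \<longrightarrow> w' \<in> \<Union>\<W>"
proof -
  let ?F = "{w' \<in> tower. \<forall>i<m. w' (2 * i) = w (2 * i)}"
  define C where "C = truncate N ` ?F"
  have finC: "finite C" unfolding C_def by (rule finite_truncate_fibre)
  define D where "D x y = (\<Sum>i<2*N. \<bar>x i - y i\<bar>)" for x y :: "nat \<Rightarrow> real"
  have D_tri: "D x y \<le> D x c + D y c" for x y c
    unfolding D_def sum.distrib[symmetric] by (intro sum_mono) auto
  have D_le: "\<bar>x i - y i\<bar> \<le> D x y" if "i < 2 * N" for x y i
    unfolding D_def using that by (intro member_le_sum) auto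
  have D_pos: "D c c' > 0" if cc: "c \<in> C" "c' \<in> C" "c \<noteq> c'" for c c'
  proof -
    obtain i where i: "c i \<noteq> c' i" using cc(3) by blast
    then have "i < 2 * N" using cc by (auto simp: C_def truncate_def split: if_splits)
    with i D_le[of i c c'] show ?thesis by auto
  qed
  \<comment> \<open>Half the least separation keeps the balls disjoint; including
    \<open>\<rho>\<close> in the minimum bounds their diameter.\<close>
  define \<rho>' where "\<rho>' = Min (insert \<rho> ((\<lambda>(c, c'). D c c') ` {(c, c'). c \<in> C \<and> c' \<in> C \<and> c \<noteq> c'})) / 2"
  have fin: "finite {(c, c'). c \<in> C \<and> c' \<in> C \<and> c \<noteq> c'}"
    by (rule finite_subset[of _ "C \<times> C"]) (use finC in auto)
  have \<rho>'_pos: "\<rho>' > 0" using fin \<rho> D_pos by (auto simp: \<rho>'_def)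
  have \<rho>'_le: "2 * \<rho>' \<le> \<rho>" using fin by (simp add: \<rho>'_def)
  have sep: "2 * \<rho>' \<le> D c c'" if "c \<in> C" "c' \<in> C" "c \<noteq> c'" for c c'
  proof -
    have "D c c' \<in> (\<lambda>(c, c'). D c c') ` {(c, c'). c \<in> C \<and> c' \<in> C \<and> c \<noteq> c'}"
      using that by force
    then show ?thesis using fin by (simp add: \<rho>'_def)
  qed
  have D_sym: "D x y = D y x" for x y by (simp add: D_def abs_minus_commute)
  define B where "B c = {x. D x c < \<rho>'}" for c
  have cont_D: "continuous_on UNIV (\<lambda>x. D x c)" for c
    unfolding D_def by (intro continuous_intros continuous_on_coordinate)
  have openB: "open (B c)" for c
    unfolding B_def by (intro open_Collect_less cont_D continuous_intros)
  let ?Z = "tower - (\<Union>c\<in>C. B c)"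
  have "\<exists>\<delta>>0. \<forall>w'\<in>?Z. \<delta> \<le> base_dist w' w"
  proof (cases "?Z = {}")
    case False
    have cont: "continuous_on ?Z (\<lambda>w'. base_dist w' w)"
      unfolding base_dist_def
      by (intro continuous_intros continuous_on_coordinate)
    have "compact ?Z"
      using openB by (intro compact_diff compact_tower) auto
    then obtain v where v: "v \<in> ?Z" "\<forall>w'\<in>?Z. base_dist v w \<le> base_dist w' w"
      using continuous_attains_inf[OF _ False cont] by blast
    have "base_dist v w > 0"
    proof (rule ccontr)
      assume "\<not> base_dist v w > 0"
      moreover have "0 \<le> base_dist v w" by (simp add: base_dist_def sum_nonneg)
      ultimately have "base_dist v w = 0" by simp
      then have "v \<in> ?F" using v(1) by (auto simp: base_dist_def sum_nonneg_eq_0_iff)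
      then have "truncate N v \<in> C" by (auto simp: C_def)
      moreover have "D v (truncate N v) = 0" by (simp add: D_def truncate_def)
      ultimately show False using v(1) \<rho>'_pos by (auto simp: B_def)
    qed
    with v(2) show ?thesis by blast
  next
    case True
    then have "\<forall>w'\<in>?Z. 1 \<le> base_dist w' w" by blast
    then show ?thesis using zero_less_one by blast
  qed
  then obtain \<delta> where \<delta>: "\<delta> > 0" "\<And>w'. w' \<in> ?Z \<Longrightarrow> \<delta> \<le> base_dist w' w" by blast
  show thesis
  proof (rule that[of \<delta> "B ` C"])
    have disj: "V \<inter> V' = {}" if V: "V \<in> B ` C" "V' \<in> B ` C" "V \<noteq> V'" for V V'
    proof -
      obtain c c' where c: "V = B c" "V' = B c'" "c \<in> C" "c' \<in> C" using V by blast
      have False if "x \<in> V" "x \<in> V'" for x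
      proof -
        have "D x c < \<rho>'" "D x c' < \<rho>'" "c \<noteq> c'" using that c V(3) by (auto simp: B_def)
        then show False
          using sep[of c c'] D_tri[of c c' x] D_sym[of c x] D_sym[of c' x] c by linarith
      qed
      then show ?thesis by blast
    qed
    have small: "\<bar>x i - y i\<bar> < \<rho>" if V: "V \<in> B ` C" "x \<in> V" "y \<in> V" "i < N" for V x y i
    proof -
      obtain c where "V = B c" using V(1) by blast
      then have "D x c < \<rho>'" "D y c < \<rho>'" using V by (auto simp: B_def)
      then show ?thesis using D_tri[of x y c] D_le[of i x y] \<rho>'_le V(4) by linarith
    qed
    show "disjoint_small N \<rho> (B ` C)"
      unfolding disjoint_small_def
    proof (intro conjI ballI impI allI)
      show "finite (B ` C)" using finC by simp
      show "open V" if "V \<in> B ` C" for V using that openB by blast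
    qed (rule disj small; assumption)+
    show "\<forall>w'\<in>tower. base_dist w' w < \<delta> \<longrightarrow> w' \<in> \<Union> (B ` C)"
      using \<delta>(2) by force
  qed (rule \<delta>(1))
qed

text \<open>The Lebesgue number argument for the pseudometric \<open>base_dist\<close>: halved radii
  in a finite subcover leave room for the triangle inequality and make \<open>\<delta>\<close>
  uniform.\<close>

lemma base_neighbourhoods:
  assumes \<rho>: "\<rho> > 0"
  obtains \<delta> where "\<delta> > 0" "\<forall>P. P \<subseteq> tower \<and> (\<forall>x\<in>P. \<forall>y\<in>P. base_dist x y < \<delta>) \<longrightarrow>
    (\<exists>\<W>. disjoint_small N \<rho> \<W> \<and> P \<subseteq> \<Union>\<W>)"
proof -
  have "\<exists>\<delta> \<W>. \<delta> > 0 \<and> disjoint_small N \<rho> \<W> \<and> (\<forall>w'\<in>tower. base_dist w' w < \<delta> \<longrightarrow> w' \<in> \<Union>\<W>)" for w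
    by (rule fibre_neighbourhood[OF \<rho>, of N w]) blast
  then obtain d \<W> where d: "\<And>w. d w > 0" "\<And>w. disjoint_small N \<rho> (\<W> w)"
    "\<And>w w'. w' \<in> tower \<Longrightarrow> base_dist w' w < d w \<Longrightarrow> w' \<in> \<Union>(\<W> w)"
    by metis
  have cont: "continuous_on UNIV (\<lambda>w'. base_dist w' w)" for w
    unfolding base_dist_def by (intro continuous_intros continuous_on_coordinate)
  define G where "G w = {w'. base_dist w' w < d w / 2}" for w
  have openG: "open (G w)" for w
    unfolding G_def by (intro open_Collect_less cont continuous_intros)
  have "w \<in> G w" for w using d(1)[of w] by (simp add: G_def base_dist_def)
  then have "tower \<subseteq> (\<Union>w\<in>tower. G w)" by blast
  then obtain A where A: "A \<subseteq> tower" "finite A" "tower \<subseteq> (\<Union>w\<in>A. G w)"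
    by (rule compactE_image[OF compact_tower openG])
  define \<delta> where "\<delta> = Min (insert 1 ((\<lambda>w. d w / 2) ` A))"
  have "\<delta> \<le> d w / 2" if "w \<in> A" for w
    unfolding \<delta>_def using A(2) that by (intro Min_le) auto
  moreover have "\<delta> > 0" using A(2) d(1) by (simp add: \<delta>_def)
  ultimately have \<delta>: "\<delta> > 0" "\<And>w. w \<in> A \<Longrightarrow> \<delta> \<le> d w / 2" by blast+
  have *: "\<exists>\<W>. disjoint_small N \<rho> \<W> \<and> P \<subseteq> \<Union>\<W>" if P: "P \<subseteq> tower" "\<forall>x\<in>P. \<forall>y\<in>P. base_dist x y < \<delta>" for P
  proof (cases "P = {}")
    case True
    then show ?thesis using d(2) by auto
  next
    case False
    then obtain x where x: "x \<in> P" by blast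
    then obtain w where w: "w \<in> A" "base_dist x w < d w / 2" using A(3) P(1) by (auto simp: G_def)
    have "y \<in> \<Union>(\<W> w)" if "y \<in> P" for y
    proof (rule d(3))
      have "base_dist y w \<le> base_dist y x + base_dist x w"
        unfolding base_dist_def sum.distrib[symmetric] by (intro sum_mono) auto
      also have "\<dots> < d w" using P(2) that x w \<delta>(2)[OF w(1)] by fastforce
      finally show "base_dist y w < d w" .
    qed (use that P in auto)
    then show ?thesis using d(2) by blast
  qed
  show thesis
    by (rule that[OF \<delta>(1)], intro allI impI, elim conjE, rule *)
qed

lemma refinable: "refinable_with_multiplicity (top_of_set tower) (Suc m)"
  unfolding refinable_with_multiplicity_def
proof (intro allI impI; elim conjE)
  fix \<U> assume \<U>: "finite \<U>" "open_cover (top_of_set tower) \<U>"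
  obtain \<rho> N where \<rho>: "\<rho> > 0" "\<forall>P. P \<subseteq> tower \<and> P \<noteq> {} \<and>
      (\<forall>x\<in>P. \<forall>y\<in>P. \<forall>i<N. \<bar>x i - y i\<bar> < \<rho>) \<longrightarrow> (\<exists>U\<in>\<U>. P \<subseteq> U)"
    by (rule coordinate_Lebesgue_number[OF compact_tower, of \<U>]) (use \<U>(2) in \<open>auto simp: open_cover_def\<close>)
  obtain \<delta> where \<delta>: "\<delta> > 0" "\<forall>P. P \<subseteq> tower \<and> (\<forall>x\<in>P. \<forall>y\<in>P. base_dist x y < \<delta>) \<longrightarrow>
    (\<exists>\<W>. disjoint_small N \<rho> \<W> \<and> P \<subseteq> \<Union>\<W>)"
    by (rule base_neighbourhoods[OF \<rho>(1)])
  \<comment> \<open>Bricks have width below 1 in each coordinate, so after scaling by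
    \<open>1 / M\<close> the \<open>base_dist\<close> within a cell is at most \<open>m / M\<close>,
    which must be less than \<open>\<delta>\<close>.\<close>
  obtain M :: nat where "real m / \<delta> + 1 < real M" using reals_Archimedean2 by blast
  moreover have "0 \<le> real m / \<delta>" using \<delta>(1) by simp
  ultimately have "M \<ge> 1" "real m / \<delta> < real M" by linarith+
  then have M: "real m / real M < \<delta>" "M \<ge> 1"
    using \<delta>(1) by (simp_all add: divide_simps mult.commute)
  define cells where "cells S a = {w \<in> tower. (\<lambda>i. real M * w (2 * i)) \<in> brick m S a}" for S a
  have *: "\<exists>\<W>. disjoint_small N \<rho> \<W> \<and> cells S a \<subseteq> \<Union>\<W>" if S: "S \<subseteq> {..<m}" for S a
  proof (rule \<delta>(2)[rule_format], intro conjI ballI)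
    fix x y assume "x \<in> cells S a" "y \<in> cells S a"
    then have "\<bar>real M * x (2 * i) - real M * y (2 * i)\<bar> < 1" if "i < m" for i
      using brick_diff[OF _ _ S that] unfolding cells_def by blast
    then have "real M * \<bar>x (2 * i) - y (2 * i)\<bar> \<le> 1" if "i < m" for i
      using that by (simp add: abs_mult less_imp_le flip: right_diff_distrib)
    then have "\<bar>x (2 * i) - y (2 * i)\<bar> \<le> 1 / real M" if "i < m" for i
      using that M(2) by (simp add: field_simps)
    then have "base_dist x y \<le> (\<Sum>i<m. 1 / real M)"
      unfolding base_dist_def by (intro sum_mono) auto
    then show "base_dist x y < \<delta>" using M(1) by simp
  qed (auto simp: cells_def)
  define \<W> where "\<W> S a = (SOME \<W>. disjoint_small N \<rho> \<W> \<and> cells S a \<subseteq> \<Union>\<W>)" for S a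
  have W: "disjoint_small N \<rho> (\<W> S a) \<and> cells S a \<subseteq> \<Union>(\<W> S a)" if "S \<subseteq> {..<m}" for S a
    unfolding \<W>_def by (rule someI_ex[OF *[OF that]])
  have \<W>: "finite (\<W> S a)" "\<And>V. V \<in> \<W> S a \<Longrightarrow> open V"
    "\<And>V V'. V \<in> \<W> S a \<Longrightarrow> V' \<in> \<W> S a \<Longrightarrow> V \<noteq> V' \<Longrightarrow> V \<inter> V' = {}"
    "\<And>V x y i. V \<in> \<W> S a \<Longrightarrow> x \<in> V \<Longrightarrow> y \<in> V \<Longrightarrow> i < N \<Longrightarrow> \<bar>x i - y i\<bar> < \<rho>"
    "cells S a \<subseteq> \<Union>(\<W> S a)" if "S \<subseteq> {..<m}" for S a
    using W[OF that, of a] unfolding disjoint_small_def by auto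
  define A where "A = PiE {..<m} (\<lambda>_. {0..int M + 1})"
  \<comment> \<open>Each cell over a brick with \<open>card S = j\<close> is cut by the disjoint
    sets chosen for it; the values \<open>j = 0, ..., m\<close> give \<open>m + 1\<close> disjoint
    families.\<close>
  define \<V> where "\<V> j = {V. V \<noteq> {} \<and> (\<exists>S a B. S \<subseteq> {..<m} \<and> card S = j \<and> a \<in> A \<and> B \<in> \<W> S a \<and> V = cells S a \<inter> B)}" for j
  have open_cells: "openin (top_of_set tower) (cells S a)" if S: "S \<subseteq> {..<m}" for S a
  proof -
    have "finite S" using S finite_subset by blast
    have "cells S a = tower \<inter> ((\<Inter>i\<in>S. {w. \<bar>real M * w (2 * i) - of_int (a i)\<bar> < brick_threshold m (card S)}) \<inter>
       (\<Inter>i\<in>{..<m} - S. {w. of_int (a i) + brick_threshold m (card S) < real M * w (2 * i)} \<inter>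
          {w. real M * w (2 * i) < of_int (a i) + 1 - brick_threshold m (card S)}))"
      by (auto simp: cells_def brick_def)
    then show ?thesis
      using \<open>finite S\<close>
      by (auto intro!: openin_open_Int open_Int open_INT open_Collect_less continuous_intros continuous_on_coordinate)
  qed
  have finV: "finite (\<V> j)" for j
  proof (rule finite_subset)
    show "\<V> j \<subseteq> (\<Union>S\<in>Pow {..<m}. \<Union>a\<in>A. (\<lambda>B. cells S a \<inter> B) ` \<W> S a)"
      by (auto simp: \<V>_def)
    show "finite (\<Union>S\<in>Pow {..<m}. \<Union>a\<in>A. (\<lambda>B. cells S a \<inter> B) ` \<W> S a)"
      using \<W>(1) by (auto simp: A_def intro!: finite_UN_I finite_PiE)
  qed
  have disjoint: "V = V'" if V: "V \<in> \<V> j" "V' \<in> \<V> j" and w: "w \<in> V" "w \<in> V'" for V V' w j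
  proof -
    obtain S a B where 1: "S \<subseteq> {..<m}" "card S = j" "a \<in> A" "B \<in> \<W> S a" "V = cells S a \<inter> B"
      using V(1) by (auto simp: \<V>_def)
    obtain S' a' B' where 2: "S' \<subseteq> {..<m}" "card S' = j" "a' \<in> A" "B' \<in> \<W> S' a'" "V' = cells S' a' \<inter> B'"
      using V(2) by (auto simp: \<V>_def)
    have "S = S' \<and> (\<forall>i<m. a i = a' i)"
      using w 1 2 by (intro brick_disjoint[of "\<lambda>i. real M * w (2 * i)"]) (auto simp: cells_def)
    \<comment> \<open>Full equality, not just below \<open>m\<close>, is required because
      \<open>\<W> S a\<close> was chosen separately for each \<open>a\<close>; extensionality of
      \<open>A\<close> provides it.\<close>
    moreover have "a = a'"
      using calculation 1(3) 2(3) by (auto simp: A_def intro: PiE_ext)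
    ultimately have "B = B'" using \<W>(3)[of S B a B'] 1 2 w by auto
    with \<open>a = a'\<close> \<open>S = S' \<and> _\<close> 1 2 show ?thesis by simp
  qed
  show "\<exists>\<V>. finite \<V> \<and> open_cover (top_of_set tower) \<V> \<and> refines \<V> \<U> \<and>
    (\<forall>w\<in>topspace (top_of_set tower). card {V \<in> \<V>. w \<in> V} \<le> Suc m)"
  proof (intro exI[of _ "\<Union>j\<le>m. \<V> j"] conjI)
    show "finite (\<Union>j\<le>m. \<V> j)" using finV by blast
    have "openin (top_of_set tower) V" if "V \<in> \<V> j" for V j
      using that open_cells \<W>(2) by (auto simp: \<V>_def intro!: openin_Int_open)
    moreover have "w \<in> \<Union> (\<Union>j\<le>m. \<V> j)" if w: "w \<in> tower" for w
    proof -
      have "w \<in> stage 0" using w by (simp add: tower_def)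
      then have "0 \<le> real M * w (2 * i)" "real M * w (2 * i) \<le> real M" if "i < m" for i
        using that by (auto simp: stage_def unit_box_def abs_le_iff intro!: mult_left_le)
      then obtain S a where S: "S \<subseteq> {..<m}" "a \<in> A" "(\<lambda>i. real M * w (2 * i)) \<in> brick m S a"
        using brick_cover[of m "\<lambda>i. real M * w (2 * i)" M] unfolding A_def by blast
      then have "w \<in> cells S a" using w by (simp add: cells_def)
      then obtain B where B: "B \<in> \<W> S a" "w \<in> B" using \<W>(5)[OF S(1)] by blast
      have "cells S a \<inter> B \<in> \<V> (card S)"
        using S B \<open>w \<in> cells S a\<close> by (auto simp: \<V>_def)
      moreover have "card S \<le> m" using card_mono[OF _ S(1)] by simp
      ultimately show ?thesis using B \<open>w \<in> cells S a\<close> by blast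
    qed
    moreover have "V \<subseteq> tower" if "V \<in> \<V> j" for V j
      using that by (auto simp: \<V>_def cells_def)
    ultimately show "open_cover (top_of_set tower) (\<Union>j\<le>m. \<V> j)"
      unfolding open_cover_def by (auto; blast)
    have "\<exists>U\<in>\<U>. V \<subseteq> U" if V: "V \<in> \<V> j" for V j
    proof (rule \<rho>(2)[rule_format])
      obtain S a B where 1: "S \<subseteq> {..<m}" "card S = j" "a \<in> A" "B \<in> \<W> S a" "V = cells S a \<inter> B" "V \<noteq> {}"
        using V by (auto simp: \<V>_def)
      then show "V \<subseteq> tower \<and> V \<noteq> {} \<and> (\<forall>x\<in>V. \<forall>y\<in>V. \<forall>i<N. \<bar>x i - y i\<bar> < \<rho>)"
        using \<W>(4)[OF 1(1,4)] by (auto simp: cells_def)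
    qed
    then show "refines (\<Union>j\<le>m. \<V> j) \<U>" by (auto simp: refines_def)
    show "\<forall>w\<in>topspace (top_of_set tower). card {V \<in> \<Union>j\<le>m. \<V> j. w \<in> V} \<le> Suc m"
    proof
      fix w
      have "{V \<in> \<Union>j\<le>m. \<V> j. w \<in> V} = (\<Union>j\<le>m. {V \<in> \<V> j. w \<in> V})" by blast
      also have "card \<dots> \<le> (\<Sum>j\<le>m. card {V \<in> \<V> j. w \<in> V})"
        by (intro card_UN_le) simp
      also have "\<dots> \<le> (\<Sum>j\<le>m. 1)"
        by (intro sum_mono card_le_1_if_disjoint disjoint)
      finally show "card {V \<in> \<Union>j\<le>m. \<V> j. w \<in> V} \<le> Suc m" by simp
    qed
  qed
qed

lemma covering_dim_tower:
  assumes "m \<ge> 1"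
  shows "covering_dim (top_of_set tower) = ereal (real m)"
  unfolding covering_dim_def
proof (rule antisym)
  show "(INF k\<in>{k. refinable_with_multiplicity (top_of_set tower) k}. ereal (real k - 1)) \<le> ereal (real m)"
    using refinable by (intro INF_lower2[of "Suc m"]) auto
  show "ereal (real m) \<le> (INF k\<in>{k. refinable_with_multiplicity (top_of_set tower) k}. ereal (real k - 1))"
    using multiplicity_gt[OF assms] by (intro INF_greatest) fastforce
qed

end

subsection \<open>Density of the functions with exact roots\<close>

text \<open>Lists with rational coefficients form a countable type, so all polynomials can be
  enumerated along the levels.\<close>

type_synonym rat_poly = "(rat \<times> nat list) list"

definition poly_eval :: "rat_poly \<Rightarrow> (nat \<Rightarrow> real) \<Rightarrow> real" where
  "poly_eval p w = (\<Sum>(c, is)\<leftarrow>p. of_rat c * (\<Prod>i\<leftarrow>is. w i))"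

definition poly_vars :: "rat_poly \<Rightarrow> nat set" where
  "poly_vars p = (\<Union>(c, is)\<in>set p. set is)"

lemma poly_eval_append: "poly_eval (p @ q) w = poly_eval p w + poly_eval q w"
  by (simp add: poly_eval_def)

lemma poly_eval_mult:
  "poly_eval (concat (map (\<lambda>(c, is). map (\<lambda>(d, js). (c * d, is @ js)) q) p)) w = poly_eval p w * poly_eval q w"
proof (induction p)
  case (Cons t p)
  obtain c "is" where t: "t = (c, is)" by (cases t)
  have "poly_eval (map (\<lambda>(d, js). (c * d, is @ js)) q) w = of_rat c * (\<Prod>i\<leftarrow>is. w i) * poly_eval q w"
    by (induction q) (auto simp: poly_eval_def of_rat_mult algebra_simps)
  with Cons show ?case
    by (simp add: t poly_eval_append algebra_simps) (simp add: poly_eval_def algebra_simps)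
qed (simp add: poly_eval_def)

lemma continuous_on_poly_eval: "continuous_on S (poly_eval p)"
proof -
  have mono: "continuous_on S (\<lambda>w. \<Prod>i\<leftarrow>is. w i)" for "is" :: "nat list"
    by (induction "is") (auto intro!: continuous_intros continuous_on_coordinate)
  show ?thesis
    by (induction p) (auto simp: poly_eval_def[abs_def] intro!: continuous_intros mono)
qed

lemma poly_eval_cong:
  assumes "\<And>i. i \<in> poly_vars p \<Longrightarrow> w i = w' i"
  shows "poly_eval p w = poly_eval p w'"
proof -
  have "(\<Prod>i\<leftarrow>is. w i) = (\<Prod>i\<leftarrow>is. w' i)" if "(c, is) \<in> set p" for c "is"
    using that assms by (intro arg_cong[where f=prod_list] map_cong) (auto simp: poly_vars_def)
  then show ?thesis
    unfolding poly_eval_def by (intro arg_cong[where f=sum_list] map_cong) auto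
qed

text \<open>Rational polynomials lack the irrational constants, so Stone--Weierstrass is applied to
  the algebra \<open>R\<close> of all continuous functions that they approximate uniformly.\<close>

lemma poly_eval_dense:
  fixes S :: "(nat \<Rightarrow> real) set"
  assumes S: "compact S" and h: "continuous_on S h" and \<epsilon>: "\<epsilon> > 0"
  shows "\<exists>p. \<forall>w\<in>S. \<bar>h w - poly_eval p w\<bar> < \<epsilon>"
proof -
  define R where "R = {g. continuous_on S g \<and> (\<forall>\<epsilon>>0. \<exists>p. \<forall>w\<in>S. \<bar>g w - poly_eval p w\<bar> < \<epsilon>)}"
  have poly: "poly_eval p \<in> R" for p
    unfolding R_def using continuous_on_poly_eval by (auto intro!: exI[of _ p])
  interpret function_ring_on R S
  proof
    show "compact S" by (rule S)
    show "continuous_on S g" if "g \<in> R" for g using that by (simp add: R_def)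
    show "(\<lambda>w. f w + g w) \<in> R" if fg: "f \<in> R" "g \<in> R" for f g
    proof -
      have "\<exists>p. \<forall>w\<in>S. \<bar>f w + g w - poly_eval p w\<bar> < \<epsilon>" if "\<epsilon> > 0" for \<epsilon>
      proof -
        have half: "\<epsilon> / 2 > 0" using that by simp
        obtain p q where p: "\<forall>w\<in>S. \<bar>f w - poly_eval p w\<bar> < \<epsilon> / 2" and q: "\<forall>w\<in>S. \<bar>g w - poly_eval q w\<bar> < \<epsilon> / 2"
          using fg half unfolding R_def by blast
        have "\<bar>f w + g w - poly_eval (p @ q) w\<bar> < \<epsilon>" if "w \<in> S" for w
          using bspec[OF p that] bspec[OF q that] unfolding poly_eval_append by linarith
        then show ?thesis by blast
      qed
      then show ?thesis using fg by (auto simp: R_def intro!: continuous_intros)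
    qed
    show "(\<lambda>w. f w * g w) \<in> R" if fg: "f \<in> R" "g \<in> R" for f g
    proof -
      have cont: "continuous_on S f" "continuous_on S g" using fg by (auto simp: R_def)
      obtain B1 where B1: "\<And>w. w \<in> S \<Longrightarrow> \<bar>f w\<bar> \<le> B1"
        using compact_imp_bounded[OF compact_continuous_image[OF cont(1) S]] by (auto simp: bounded_iff)
      obtain B2 where B2: "\<And>w. w \<in> S \<Longrightarrow> \<bar>g w\<bar> \<le> B2"
        using compact_imp_bounded[OF compact_continuous_image[OF cont(2) S]] by (auto simp: bounded_iff)
      define B where "B = \<bar>B1\<bar> + \<bar>B2\<bar> + 1"
      have B: "\<bar>f w\<bar> \<le> B" "\<bar>g w\<bar> \<le> B" if "w \<in> S" for w
        using B1[OF that] B2[OF that] by (auto simp: B_def)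
      have "B \<ge> 1" by (simp add: B_def)
      have "\<exists>p. \<forall>w\<in>S. \<bar>f w * g w - poly_eval p w\<bar> < \<epsilon>" if "\<epsilon> > 0" for \<epsilon>
      proof -
        \<comment> \<open>The product error is at most
          \<open>B * \<delta> + \<delta> * (2 * B)\<close>, which is below
          \<open>4 * B * \<delta>\<close>; \<open>\<delta> \<le> 1\<close> gives the bound
          \<open>2 * B\<close> on the second polynomial.\<close>
        define \<delta> where "\<delta> = min 1 (\<epsilon> / (4 * B))"
        have \<delta>: "\<delta> > 0" "\<delta> \<le> 1" "4 * B * \<delta> \<le> \<epsilon>"
          using \<open>B \<ge> 1\<close> that by (auto simp: \<delta>_def min_def field_simps)
        obtain p q where p: "\<forall>w\<in>S. \<bar>f w - poly_eval p w\<bar> < \<delta>" and q: "\<forall>w\<in>S. \<bar>g w - poly_eval q w\<bar> < \<delta>"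
          using fg \<delta>(1) unfolding R_def by blast
        have "\<bar>f w * g w - poly_eval p w * poly_eval q w\<bar> < \<epsilon>" if "w \<in> S" for w
        proof -
          have "\<bar>poly_eval q w\<bar> \<le> 2 * B"
            using bspec[OF q that] B(2)[OF that] \<delta>(2) \<open>B \<ge> 1\<close> by linarith
          have "\<bar>f w * g w - poly_eval p w * poly_eval q w\<bar>
              = \<bar>f w * (g w - poly_eval q w) + (f w - poly_eval p w) * poly_eval q w\<bar>"
            by (simp add: algebra_simps)
          also have "\<dots> \<le> \<bar>f w\<bar> * \<bar>g w - poly_eval q w\<bar> + \<bar>f w - poly_eval p w\<bar> * \<bar>poly_eval q w\<bar>"
            using abs_triangle_ineq by (simp add: abs_mult[symmetric])
          also have "\<dots> \<le> B * \<delta> + \<delta> * (2 * B)"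
            using B(1)[OF that] bspec[OF q that] bspec[OF p that] \<open>\<bar>poly_eval q w\<bar> \<le> 2 * B\<close> \<open>B \<ge> 1\<close> \<delta>(1)
            by (intro add_mono mult_mono) auto
          also have "\<dots> < 4 * B * \<delta>" using \<open>B \<ge> 1\<close> \<delta>(1) by simp
          finally show ?thesis using \<delta>(3) by linarith
        qed
        then show ?thesis
          by (intro exI[of _ "concat (map (\<lambda>(c, is). map (\<lambda>(d, js). (c * d, is @ js)) q) p)"])
             (simp add: poly_eval_mult)
      qed
      then show ?thesis using cont by (auto simp: R_def intro!: continuous_intros)
    qed
    show "(\<lambda>_. c) \<in> R" for c
    proof -
      have "\<exists>p. \<forall>w\<in>S. \<bar>c - poly_eval p w\<bar> < \<epsilon>" if e: "\<epsilon> > 0" for \<epsilon>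
      proof -
        obtain q where "c < of_rat q" "of_rat q < c + \<epsilon>"
          using of_rat_dense[of c "c + \<epsilon>"] e by auto
        then show ?thesis by (intro exI[of _ "[(q, [])]"]) (simp add: poly_eval_def)
      qed
      then show ?thesis by (simp add: R_def)
    qed
    show "\<exists>g\<in>R. g x \<noteq> g y" if "x \<noteq> y" for x y
    proof -
      obtain i where "x i \<noteq> y i" using \<open>x \<noteq> y\<close> by blast
      then have "poly_eval [(1, [i])] x \<noteq> poly_eval [(1, [i])] y" by (simp add: poly_eval_def)
      then show ?thesis using poly by blast
    qed
  qed
  have half: "\<epsilon> / 2 > 0" using \<epsilon> by simp
  obtain g where g: "g \<in> R" "\<forall>w\<in>S. \<bar>h w - g w\<bar> < \<epsilon> / 2"
    using Stone_Weierstrass_basic[OF h half] by blast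
  obtain p where p: "\<forall>w\<in>S. \<bar>g w - poly_eval p w\<bar> < \<epsilon> / 2"
    using g(1) half unfolding R_def by blast
  have "\<bar>h w - poly_eval p w\<bar> < \<epsilon>" if "w \<in> S" for w
    using bspec[OF g(2) that] bspec[OF p that] by linarith
  then show ?thesis by blast
qed

section \<open>Polynomials and exponents distributed over the levels\<close>

definition complex_poly :: "rat_poly \<Rightarrow> rat_poly \<Rightarrow> (nat \<Rightarrow> real) \<Rightarrow> complex" where
  "complex_poly p q w = Complex (poly_eval p w) (poly_eval q w)"

text \<open>The radial retraction onto the closed unit disc: it enforces the bound required of
  \<open>f k\<close> and keeps continuity.\<close>

definition clip :: "complex \<Rightarrow> complex" where
  "clip x = x / of_real (max 1 (norm x))"

lemma clip_eq: "norm x \<le> 1 \<Longrightarrow> clip x = x"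
  by (simp add: clip_def max_def)

lemma norm_clip: "norm (clip x) \<le> 1"
  by (simp add: clip_def norm_divide divide_le_eq)

lemma continuous_on_clip [continuous_intros]: "continuous_on S h \<Longrightarrow> continuous_on S (\<lambda>w. clip (h w))"
  unfolding clip_def by (intro continuous_intros) auto

text \<open>Every triple of two polynomials and an exponent occurs at arbitrarily large levels \<open>k\<close>; at the
  levels where the polynomials involve coordinates that are not yet available, no root is adjoined.\<close>

definition level :: "nat \<Rightarrow> rat_poly \<times> rat_poly \<times> nat" where
  "level k = from_nat (fst (prod_decode k))"

definition level_exponent :: "nat \<Rightarrow> nat" where
  "level_exponent k = (case level k of (p, q, r) \<Rightarrow> Suc r)"

definition level_function :: "nat \<Rightarrow> (nat \<Rightarrow> real) \<Rightarrow> complex" where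
  "level_function k w = (case level k of (p, q, r) \<Rightarrow>
     if poly_vars p \<union> poly_vars q \<subseteq> {..<2 * k} then clip (complex_poly p q w) else 0)"

lemma root_tower_levels: "root_tower level_exponent level_function"
proof
  fix k
  obtain p q r where l: "level k = (p, q, r)" by (cases "level k")
  show "level_exponent k \<ge> 1" by (simp add: level_exponent_def l)
  show "continuous_on UNIV (level_function k)"
  proof (cases "poly_vars p \<union> poly_vars q \<subseteq> {..<2 * k}")
    case True
    then have "level_function k = (\<lambda>w. clip (complex_poly p q w))"
      by (simp add: level_function_def fun_eq_iff l)
    then show ?thesis
      by (simp add: complex_poly_def Complex_eq) (intro continuous_intros continuous_on_poly_eval)
  next
    case False
    then have "level_function k = (\<lambda>_. 0)"
      by (auto simp: level_function_def fun_eq_iff l)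
    then show ?thesis by simp
  qed
  show "norm (level_function k w) \<le> 1" for w
    by (simp add: level_function_def l norm_clip)
  show "level_function k w = level_function k w'" if "\<And>i. i < 2 * k \<Longrightarrow> w i = w' i" for w w'
  proof (cases "poly_vars p \<union> poly_vars q \<subseteq> {..<2 * k}")
    case True
    then have "poly_eval p w = poly_eval p w'" "poly_eval q w = poly_eval q w'"
      by (auto intro!: poly_eval_cong that)
    then show ?thesis by (simp add: level_function_def l complex_poly_def)
  qed (auto simp: level_function_def l)
qed

lemma exists_level:
  assumes "n \<ge> 1"
  obtains k where "k \<ge> m" "level_exponent k = n" "level_function k = (\<lambda>w. clip (complex_poly p q w))"
proof -
  have "finite (poly_vars p \<union> poly_vars q)" by (auto simp: poly_vars_def)
  then obtain b where b: "\<And>i. i \<in> poly_vars p \<union> poly_vars q \<Longrightarrow> i < b"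
    using finite_nat_bounded by (metis lessThan_iff subsetD)
  \<comment> \<open>The free second component of the pair pushes \<open>k\<close> past
    \<open>m\<close> and past every variable of the polynomials; \<open>n - 1\<close> offsets the
    \<open>Suc\<close> in \<open>level_exponent\<close>.\<close>
  define k where "k = prod_encode (to_nat (p, q, n - 1), max m b)"
  have k: "max m b \<le> k" unfolding k_def by (rule le_prod_encode_2)
  have l: "level k = (p, q, n - 1)" by (simp add: level_def k_def)
  have "i < 2 * k" if "i \<in> poly_vars p \<union> poly_vars q" for i
    using b[OF that] k by simp
  then have "poly_vars p \<union> poly_vars q \<subseteq> {..<2 * k}" by blast
  then have "level_function k = (\<lambda>w. clip (complex_poly p q w))"
    by (simp add: level_function_def fun_eq_iff l)
  moreover have "level_exponent k = n" using assms by (simp add: level_exponent_def l)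
  ultimately show thesis using that[of k] k by simp
qed

context root_tower
begin

lemma coord_power:
  assumes "w \<in> tower" "k \<ge> m"
  shows "coord k w ^ n k = f k w"
proof -
  have "w \<in> stage (Suc k)" using assms(1) by (simp add: tower_def)
  then show ?thesis using assms(2) by (simp add: stage_def)
qed

end

text \<open>Scaling \<open>F\<close> to norm at most 1/2 and approximating within 1/2 keeps the
  polynomial in the unit disc on the tower, where \<open>clip\<close> is the identity. The
  coordinate of a suitable level is then an exact root of the polynomial, and scaling back costs the
  real root of \<open>2 * B\<close>.\<close>

lemma approximately_root_closed_tower:
  assumes "r \<ge> 1"
  shows "approximately_root_closed (top_of_set (root_tower.tower m level_exponent level_function)) r"
  unfolding approximately_root_closed_def
proof (intro ballI allI impI)
  interpret root_tower m level_exponent level_function by (rule root_tower_levels)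
  fix F and \<epsilon> :: real
  assume F: "F \<in> bounded_continuous_functions (top_of_set tower)" and \<epsilon>: "\<epsilon> > 0"
  have F_cont: "continuous_on tower F"
    using F by (simp add: bounded_continuous_functions_def)
  obtain B where B: "B > 0" "\<And>w. w \<in> tower \<Longrightarrow> norm (F w) \<le> B"
    using F by (auto simp: bounded_continuous_functions_def bounded_pos)
  define h where "h w = F w / of_real (2 * B)" for w
  have h_cont: "continuous_on tower (\<lambda>w. Re (h w))" "continuous_on tower (\<lambda>w. Im (h w))"
    unfolding h_def using B(1) by (auto intro!: continuous_intros F_cont)
  have h_le: "norm (h w) \<le> 1/2" if "w \<in> tower" for w
    using B(2)[OF that] B(1) by (simp add: h_def norm_divide field_simps)
  define \<delta> where "\<delta> = min (1/2) (\<epsilon> / (4 * B))"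
  have \<delta>: "\<delta> > 0" "\<delta> \<le> 1/2" "4 * B * \<delta> \<le> \<epsilon>"
    using B(1) \<epsilon> by (auto simp: \<delta>_def min_def field_simps)
  have half: "\<delta> / 2 > 0" using \<delta>(1) by simp
  obtain p where p: "\<forall>w\<in>tower. \<bar>Re (h w) - poly_eval p w\<bar> < \<delta> / 2"
    using poly_eval_dense[OF compact_tower h_cont(1) half] by blast
  obtain q where q: "\<forall>w\<in>tower. \<bar>Im (h w) - poly_eval q w\<bar> < \<delta> / 2"
    using poly_eval_dense[OF compact_tower h_cont(2) half] by blast
  have near: "norm (h w - complex_poly p q w) < \<delta>" if "w \<in> tower" for w
    using cmod_le[of "h w - complex_poly p q w"] bspec[OF p that] bspec[OF q that]
    by (simp add: complex_poly_def)
  obtain k where k: "k \<ge> m" "level_exponent k = r" "level_function k = (\<lambda>w. clip (complex_poly p q w))"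
    by (rule exists_level[OF assms])
  have root: "coord k w ^ r = complex_poly p q w" if w: "w \<in> tower" for w
  proof -
    have "norm (complex_poly p q w) \<le> 1"
      using near[OF w] h_le[OF w] \<delta>(2) norm_triangle_ineq2[of "complex_poly p q w" "h w"]
      by (simp add: norm_minus_commute)
    then show ?thesis using coord_power[OF w k(1)] by (simp add: k clip_eq)
  qed
  define g where "g w = of_real (root r (2 * B)) * coord k w" for w
  have g_cont: "continuous_on tower g"
    unfolding g_def by (intro continuous_intros continuous_on_coord)
  have "g \<in> bounded_continuous_functions (top_of_set tower)"
    using g_cont compact_imp_bounded[OF compact_continuous_image[OF g_cont compact_tower]]
    by (simp add: bounded_continuous_functions_def)
  moreover have "norm (F w - g w ^ r) \<le> \<epsilon> / 2" if w: "w \<in> tower" for w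
  proof -
    have "of_real (root r (2 * B)) ^ r = (of_real (2 * B) :: complex)"
      using assms B(1) by (simp flip: of_real_power)
    then have "F w - g w ^ r = of_real (2 * B) * (h w - complex_poly p q w)"
      using B(1) by (simp add: g_def power_mult_distrib root[OF w] h_def right_diff_distrib)
    then have "norm (F w - g w ^ r) = 2 * B * norm (h w - complex_poly p q w)"
      using B(1) by (simp add: norm_mult)
    also have "\<dots> \<le> 2 * B * \<delta>"
      using near[OF w] B(1) by (intro mult_left_mono) auto
    finally show ?thesis using \<delta>(3) by linarith
  qed
  then have "sup_norm (top_of_set tower) (\<lambda>w. F w - g w ^ r) \<le> \<epsilon> / 2"
    unfolding sup_norm_def using \<epsilon> by (intro cSup_least) auto
  then have "sup_norm (top_of_set tower) (\<lambda>w. F w - g w ^ r) < \<epsilon>" using \<epsilon> by linarith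
  ultimately show "\<exists>g\<in>bounded_continuous_functions (top_of_set tower).
      sup_norm (top_of_set tower) (\<lambda>w. F w - g w ^ r) < \<epsilon>" by blast
qed

theorem theorem5p2:
  fixes m :: nat
  assumes "m \<ge> 1"
  shows "\<exists>X :: (nat \<Rightarrow> real) topology.
           compact_space X \<and> metrizable_space X \<and> covering_dim X = ereal (real m) \<and>
           (\<forall>n\<ge>1. approximately_root_closed X n)"
proof -
  interpret root_tower m level_exponent level_function by (rule root_tower_levels)
  have "compact_space (top_of_set tower)"
    using compact_tower by (simp add: compact_space_subtopology)
  moreover have "metrizable_space (top_of_set tower)"
    by (simp add: metrizable_space_subtopology metrizable_space_euclidean)
  ultimately show ?thesis
    using covering_dim_tower[OF assms] approximately_root_closed_tower by blast
qed

end
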